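(* Let $(M^2,T,d)$ be a closed connected two-dimensional piecewise flat metrized manifold with curvature zero, i.e. $K_i=0$ for all $i\in V(T)$. Suppose that at least one of the following holds: (1) $\ell_{ij}^*>0$ for all edges $\{i,j\}\in E(T)$; (2) $d$ is in the image of a fixed inversive distance conformal structure $\mathcal{C}^{FI}(M,T,\eta)$ with $\eta_{ij}\ge0$ for all $\{i,j\}\in E(T)$; (3) $d_{ij}>0$ for all $(i,j)\in E_+(T)$; (4) $d$ is in the image of a perpendicular bisector conformal structure $\mathcal{C}^{PB}(M,T,L)$ for some $L$; (5) for each triangle of $T$, isometrically embedded in the plane as $v_iv_jv_k$, the center $c_{ijk}$ is contained within (i.e. lies strictly inside) the circumcircle of $v_iv_jv_k$. Then $(M,T,d)$ is rigid with respect to any conformal variations: if $f:(-\varepsilon,\varepsilon)\to V(T)^*$ is a conformal variation of $(M,T,d)$ with extension $\mathcal{C}$ such that all curvatures $K_i$ of $(M,T,\mathcal{C}[f(t)])$ remain zero for all $t\in(-\varepsilon,\varepsilon)$, then for all $t$ in some neighborhood of $0$ the variation only scales the edge lengths uniformly, i.e. there are numbers $s(t)>0$ such that the lengths of $\mathcal{C}[f(t)]$ satisfy $\ell_{ij}(t)=s(t)\,\ell_{ij}(0)$ for every edge $\{i,j\}\in E(T)$.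
   Context: A triangulated manifold $(M,T)$ is a topological manifold with a triangulation $T$ (here finite, and simplices are determined by their vertices and written $\{i,j,\dots,k\}$). $V(T)$, $E(T)$, $E_+(T)$ are the sets of vertices, edges, and directed edges (each edge $\{i,j\}$ gives two directed edges $(i,j)$ and $(j,i)$); $X^*$ is the vector space of functions $X\to\mathbb{R}$. $(M,T,\ell)$, with $\ell\in E(T)^*$, is piecewise flat if every simplex can be realized as a nondegenerate Euclidean simplex with edge lengths given by $\ell$. A (piecewise flat) metric is $d\in E_+(T)^*$ such that with $\ell_{ij}=d_{ij}+d_{ji}$, $(M,T,\ell)$ is piecewise flat, and for every triangle $\{i,j,k\}$: $d_{ij}^2+d_{jk}^2+d_{ki}^2=d_{ji}^2+d_{ik}^2+d_{kj}^2$. (The $d_{ij}$ may be negative.) Then $(M,T,d)$ is a piecewise flat metrized manifold; $\mathfrak{met}(M,T)$ is the set of all metrics $d$. A conformal structure on an open set $U\subset V(T)^*$ is a smooth map $\mathcal{C}:U\to\mathfrak{met}(M,T)\subset E_+(T)^*$ such that, writing $d=\mathcal{C}[f]$ and $\ell_{ij}=d_{ij}+d_{ji}$, for each $(i,j)\in E_+(T)$ and $k\in V(T)$: $\partial\ell_{ij}/\partial f_i=d_{ij}$, and $\partial d_{ij}/\partial f_k=0$ if $k\ne i$ and $k\neq j$. A conformal variation of $(M,T,d)$ is a smooth curve $f:(-\varepsilon,\varepsilon)\to V(T)^*$ for which there is a conformal structure $\mathcal{C}:U\to\mathfrak{met}(M,T)$ with $f((-\varepsilon,\varepsilon))\subset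 U$ and $\mathcal{C}[f(0)]=d$; such $\mathcal{C}$ is called an extension of the variation. Special conformal structures (each restricted to an open domain of $f\in V(T)^*$ on which the resulting $d$ is a metric): for $\eta\in E(T)^*$, $\mathcal{C}^{FI}(M,T,\eta)$ is given by $d_{ij}=\dfrac{e^{f_i}(e^{f_i}+e^{f_j}\eta_{ij})}{\ell_{ij}(f)}$ with $\ell_{ij}(f)=\sqrt{e^{2f_i}+e^{2f_j}+2e^{f_i}e^{f_j}\eta_{ij}}$; for $L\in E(T)^*$ with $(M,T,L)$ piecewise flat, $\mathcal{C}^{PB}(M,T,L)$ is given by $d_{ij}=\frac12e^{\frac12(f_i+f_j)}L_{ij}$. $\gamma_{i,jk}$ is the angle at vertex $i$ in the Euclidean triangle $\{i,j,k\}$ with edge lengths $\ell$. The curvature at $i$ is $K_i=2\pi-\sum\gamma_{i,jk}$, the sum being over all triangles $\{i,j,k\}$ containing $i$. If the triangle $\{i,j,k\}$ is realized in the plane as $v_iv_jv_k$, its center $c_{ijk}$ is the unique point whose orthogonal projection onto each side line $v_av_b$ is the point at signed distance $d_{ab}$ from $v_a$ in the direction of $v_b$. $h_{ij,k}=\dfrac{d_{ik}-d_{ij}\cos\gamma_{i,jk}}{\sin\gamma_{i,jk}}$ is the signed distance from $c_{ijk}$ to the line $v_iv_j$ (positive on the side of the triangle). The dual length of an edge $\{i,j\}$ contained in the two triangles $\{i,j,k\}$ and $\{i,j,\ell\}$ is $\ell_{ij}^*=h_{ij,k}+h_{ij,\ell}$. *)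

theory Defs
  imports "HOL-Analysis.Analysis"
begin

section \<open>Triangulated manifolds\<close>

definition topological_manifold :: "nat \<Rightarrow> 'm topology \<Rightarrow> bool" where
  "topological_manifold n M \<longleftrightarrow>
     Hausdorff_space M \<and>
     (\<exists>\<B>. countable \<B> \<and> (\<forall>B\<in>\<B>. openin M B) \<and>
        (\<forall>U x. openin M U \<and> x \<in> U \<longrightarrow> (\<exists>B\<in>\<B>. x \<in> B \<and> B \<subseteq> U))) \<and>
     (\<forall>x\<in>topspace M. \<exists>U W. openin M U \<and> x \<in> U \<and> openin (Euclidean_space n) W \<and>
        subtopology M U homeomorphic_space subtopology (Euclidean_space n) W)"

text \<open>
  A finite triangulation is a finite abstract simplicial complex whose vertex set is the whole
  finite type \<open>'v\<close>, so that the functions on the vertices form the Euclidean space \<open>real ^ 'v\<close>.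
  Simplices are nonempty sets of vertices. The geometric realization places the vertices at the
  standard basis vectors.
\<close>

definition abstract_complex :: "'v::finite set set \<Rightarrow> bool" where
  "abstract_complex T \<longleftrightarrow>
     {} \<notin> T \<and> (\<forall>v. {v} \<in> T) \<and> (\<forall>\<sigma>\<in>T. \<forall>\<tau>. \<tau> \<subseteq> \<sigma> \<and> \<tau> \<noteq> {} \<longrightarrow> \<tau> \<in> T)"

definition geometric_realization :: "'v::finite set set \<Rightarrow> (real ^ 'v) set" where
  "geometric_realization T = (\<Union>\<sigma>\<in>T. convex hull ((\<lambda>v. axis v 1) ` \<sigma>))"

definition triangulated_manifold :: "nat \<Rightarrow> 'm topology \<Rightarrow> 'v::finite set set \<Rightarrow> bool" where
  "triangulated_manifold n M T \<longleftrightarrow>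
     topological_manifold n M \<and> abstract_complex T \<and>
     top_of_set (geometric_realization T) homeomorphic_space M"

definition directed_edges :: "'v set set \<Rightarrow> ('v \<times> 'v) set" where
  "directed_edges T = {(i, j). i \<noteq> j \<and> {i, j} \<in> T}"

definition is_triangle :: "'v set set \<Rightarrow> 'v \<Rightarrow> 'v \<Rightarrow> 'v \<Rightarrow> bool" where
  "is_triangle T i j k \<longleftrightarrow> i \<noteq> j \<and> j \<noteq> k \<and> i \<noteq> k \<and> {i, j, k} \<in> T"


section \<open>Piecewise flat metrics\<close>

definition realizes :: "('v \<Rightarrow> 'v \<Rightarrow> real) \<Rightarrow> 'v set \<Rightarrow> ('v \<Rightarrow> 'e::euclidean_space) \<Rightarrow> bool" where
  "realizes l \<sigma> p \<longleftrightarrow>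
     inj_on p \<sigma> \<and> \<not> affine_dependent (p ` \<sigma>) \<and>
     (\<forall>i\<in>\<sigma>. \<forall>j\<in>\<sigma>. i \<noteq> j \<longrightarrow> dist (p i) (p j) = l i j)"

text \<open>
  The space \<open>real ^ 'v\<close> has room for every simplex, since a simplex has at most \<open>CARD('v)\<close> vertices.
\<close>

definition piecewise_flat :: "'v::finite set set \<Rightarrow> ('v \<Rightarrow> 'v \<Rightarrow> real) \<Rightarrow> bool" where
  "piecewise_flat T l \<longleftrightarrow> (\<forall>\<sigma>\<in>T. \<exists>p :: 'v \<Rightarrow> real ^ 'v. realizes l \<sigma> p)"

text \<open>
  A function \<open>d\<close> on directed edges is curried; only its values on \<open>directed_edges T\<close> matter.
\<close>

definition len :: "('v \<Rightarrow> 'v \<Rightarrow> real) \<Rightarrow> 'v \<Rightarrow> 'v \<Rightarrow> real" where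
  "len d i j = d i j + d j i"

definition pf_metric :: "'v::finite set set \<Rightarrow> ('v \<Rightarrow> 'v \<Rightarrow> real) \<Rightarrow> bool" where
  "pf_metric T d \<longleftrightarrow>
     piecewise_flat T (len d) \<and>
     (\<forall>i j k. is_triangle T i j k \<longrightarrow>
        (d i j)\<^sup>2 + (d j k)\<^sup>2 + (d k i)\<^sup>2 = (d j i)\<^sup>2 + (d i k)\<^sup>2 + (d k j)\<^sup>2)"


section \<open>Angles, curvature, centers and dual lengths\<close>

text \<open>
  \<open>tri_angle l i j k\<close> is the angle at \<open>i\<close>, read off from any planar realization of the triangle.
\<close>

definition tri_angle :: "('v \<Rightarrow> 'v \<Rightarrow> real) \<Rightarrow> 'v \<Rightarrow> 'v \<Rightarrow> 'v \<Rightarrow> real" where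
  "tri_angle l i j k =
     (THE \<theta>. \<exists>p :: 'v \<Rightarrow> real ^ 2. realizes l {i, j, k} p \<and>
        \<theta> = arccos (((p j - p i) \<bullet> (p k - p i)) / (norm (p j - p i) * norm (p k - p i))))"

text \<open>
  The sum runs over ordered pairs \<open>(j, k)\<close>, so every triangle containing \<open>i\<close> occurs twice.
\<close>

definition curvature :: "'v::finite set set \<Rightarrow> ('v \<Rightarrow> 'v \<Rightarrow> real) \<Rightarrow> 'v \<Rightarrow> real" where
  "curvature T l i =
     2 * pi - (\<Sum>(j, k) | is_triangle T i j k. tri_angle l i j k) / 2"

definition height :: "('v \<Rightarrow> 'v \<Rightarrow> real) \<Rightarrow> 'v \<Rightarrow> 'v \<Rightarrow> 'v \<Rightarrow> real" where
  "height d i j k =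
     (d i k - d i j * cos (tri_angle (len d) i j k)) / sin (tri_angle (len d) i j k)"

text \<open>
  On a closed surface every edge lies in exactly two triangles, so this sum has two terms.
\<close>

definition dual_length :: "'v::finite set set \<Rightarrow> ('v \<Rightarrow> 'v \<Rightarrow> real) \<Rightarrow> 'v \<Rightarrow> 'v \<Rightarrow> real" where
  "dual_length T d i j = (\<Sum>k | is_triangle T i j k. height d i j k)"

text \<open>
  The point at signed distance \<open>d a b\<close> from \<open>p a\<close> towards \<open>p b\<close> lies on the line through \<open>p a\<close> and
  \<open>p b\<close>; it is the orthogonal projection of \<open>c\<close> iff its difference with \<open>c\<close> is orthogonal to that line.
\<close>

definition triangle_center ::
  "('v \<Rightarrow> 'v \<Rightarrow> real) \<Rightarrow> 'v set \<Rightarrow> ('v \<Rightarrow> real ^ 2) \<Rightarrow> real ^ 2 \<Rightarrow> bool" where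
  "triangle_center d \<sigma> p c \<longleftrightarrow>
     (\<forall>a\<in>\<sigma>. \<forall>b\<in>\<sigma>. a \<noteq> b \<longrightarrow>
        orthogonal (c - (p a + (d a b / norm (p b - p a)) *\<^sub>R (p b - p a))) (p b - p a))"

definition center_in_circumcircle ::
  "('v \<Rightarrow> 'v \<Rightarrow> real) \<Rightarrow> 'v set \<Rightarrow> ('v \<Rightarrow> real ^ 2) \<Rightarrow> bool" where
  "center_in_circumcircle d \<sigma> p \<longleftrightarrow>
     (\<exists>c z r. triangle_center d \<sigma> p c \<and> p ` \<sigma> \<subseteq> sphere z r \<and> c \<in> ball z r)"


section \<open>Conformal structures\<close>

text \<open>Smoothness on open sets, via iterated directional derivatives.\<close>

fun Ck_on :: "nat \<Rightarrow> 'a::euclidean_space set \<Rightarrow> ('a \<Rightarrow> 'b::euclidean_space) \<Rightarrow> bool" where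
  "Ck_on 0 S f \<longleftrightarrow> continuous_on S f"
| "Ck_on (Suc n) S f \<longleftrightarrow>
     (\<forall>x\<in>S. f differentiable (at x)) \<and> (\<forall>v. Ck_on n S (\<lambda>x. frechet_derivative f (at x) v))"

definition smooth_on :: "'a::euclidean_space set \<Rightarrow> ('a \<Rightarrow> 'b::euclidean_space) \<Rightarrow> bool" where
  "smooth_on S f \<longleftrightarrow> (\<forall>n. Ck_on n S f)"

definition has_partial :: "(real ^ 'v::finite \<Rightarrow> real) \<Rightarrow> 'v \<Rightarrow> real ^ 'v \<Rightarrow> real \<Rightarrow> bool" where
  "has_partial F k f D \<longleftrightarrow> ((\<lambda>t. F (f + t *\<^sub>R axis k 1)) has_real_derivative D) (at 0)"

definition conformal_structure ::
  "'v::finite set set \<Rightarrow> (real ^ 'v) set \<Rightarrow> (real ^ 'v \<Rightarrow> 'v \<Rightarrow> 'v \<Rightarrow> real) \<Rightarrow> bool" where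
  "conformal_structure T U C \<longleftrightarrow>
     open U \<and>
     (\<forall>(i, j)\<in>directed_edges T. smooth_on U (\<lambda>f. C f i j)) \<and>
     (\<forall>f\<in>U. pf_metric T (C f)) \<and>
     (\<forall>f\<in>U. \<forall>(i, j)\<in>directed_edges T.
        has_partial (\<lambda>g. len (C g) i j) i f (C f i j) \<and>
        (\<forall>k. k \<noteq> i \<and> k \<noteq> j \<longrightarrow> has_partial (\<lambda>g. C g i j) k f 0))"

definition conformal_variation ::
  "'v::finite set set \<Rightarrow> ('v \<Rightarrow> 'v \<Rightarrow> real) \<Rightarrow> real \<Rightarrow> (real \<Rightarrow> real ^ 'v) \<Rightarrow>
    (real ^ 'v) set \<Rightarrow> (real ^ 'v \<Rightarrow> 'v \<Rightarrow> 'v \<Rightarrow> real) \<Rightarrow> bool" where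
  "conformal_variation T d \<epsilon> f U C \<longleftrightarrow>
     0 < \<epsilon> \<and> smooth_on {-\<epsilon><..<\<epsilon>} f \<and>
     conformal_structure T U C \<and> f ` {-\<epsilon><..<\<epsilon>} \<subseteq> U \<and>
     (\<forall>(i, j)\<in>directed_edges T. C (f 0) i j = d i j)"

text \<open>
  The special conformal structures are restricted to open domains on which they yield metrics.
  An undirected edge function is applied to the unordered edge \<open>{i, j}\<close>.
\<close>

definition in_image_of_structure ::
  "'v::finite set set \<Rightarrow> (real ^ 'v \<Rightarrow> 'v \<Rightarrow> 'v \<Rightarrow> real) \<Rightarrow> ('v \<Rightarrow> 'v \<Rightarrow> real) \<Rightarrow> bool" where
  "in_image_of_structure T C d \<longleftrightarrow>
     (\<exists>U. open U \<and> (\<forall>f\<in>U. pf_metric T (C f)) \<and>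
        (\<exists>f\<in>U. \<forall>(i, j)\<in>directed_edges T. d i j = C f i j))"

text \<open>
  \<open>sqrt\<close> is odd on negative reals; the radicand below is positive whenever \<open>\<eta> {i, j} \<ge> 0\<close>.
\<close>

definition fixed_inversive_distance ::
  "('v::finite set \<Rightarrow> real) \<Rightarrow> real ^ 'v \<Rightarrow> 'v \<Rightarrow> 'v \<Rightarrow> real" where
  "fixed_inversive_distance \<eta> f i j =
     exp (f $ i) * (exp (f $ i) + exp (f $ j) * \<eta> {i, j}) /
     sqrt (exp (2 * f $ i) + exp (2 * f $ j) + 2 * exp (f $ i) * exp (f $ j) * \<eta> {i, j})"

definition perpendicular_bisector ::
  "('v::finite set \<Rightarrow> real) \<Rightarrow> real ^ 'v \<Rightarrow> 'v \<Rightarrow> 'v \<Rightarrow> real" where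
  "perpendicular_bisector L f i j = 1 / 2 * exp (1 / 2 * (f $ i + f $ j)) * L {i, j}"

end

theory Submission
  imports Defs
begin

text \<open>
  Let \<open>x = f'(t)\<close>, and write \<open>w\<close> for the weight (height of the center over the edge) / (length of the
  edge). By the chain rule each length satisfies \<open>l\<^sub>i\<^sub>j' = d\<^sub>i\<^sub>j x\<^sub>i + d\<^sub>j\<^sub>i x\<^sub>j\<close>, and differentiating the law
  of cosines turns this into a discrete Laplacian: the angle at \<open>i\<close> in a triangle \<open>{i, j, k}\<close> varies by
  \<open>w\<^sub>i\<^sub>j (x\<^sub>j - x\<^sub>i) + w\<^sub>i\<^sub>k (x\<^sub>k - x\<^sub>i)\<close> (\<open>tri_angle_has_derivative\<close>). If the surface stays flat, the variation
  of every curvature vanishes; pairing it with \<open>x\<close> and summing by parts shows that the Dirichlet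
  energy, the sum of \<open>w\<^sub>i\<^sub>j (x\<^sub>j - x\<^sub>i)\<^sup>2\<close> over the triangles, vanishes
  (\<open>flat_variation_dirichlet_energy\<close>).

  The energy is positive semidefinite and vanishes only if \<open>x\<close> agrees at the ends of every edge
  (\<open>dirichlet_energy_zero\<close>). If all dual lengths are positive, this is clear after collecting the
  terms of each edge. In the other four cases it already holds in each triangle. The form of one
  triangle is definite modulo constants as soon as \<open>w\<^sub>i\<^sub>j w\<^sub>j\<^sub>k + w\<^sub>j\<^sub>k w\<^sub>k\<^sub>i + w\<^sub>k\<^sub>i w\<^sub>i\<^sub>j\<close> is positive, and
  this number is \<open>d\<^sub>i\<^sub>j d\<^sub>j\<^sub>k d\<^sub>k\<^sub>i + d\<^sub>j\<^sub>i d\<^sub>k\<^sub>j d\<^sub>i\<^sub>k\<close> divided by the product of the lengths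
  (\<open>edge_weights_layout\<close>); the sign of the form is then found by evaluating it on the coordinate
  functions of the triangle, which gives twice the area. The sum of the two products is obviously
  positive when all \<open>d\<^sub>i\<^sub>j\<close> are, which covers inversive distances and perpendicular bisectors, and it
  is a positive multiple of minus the power of the center with respect to the circumcircle, which
  covers the last case.

  Both positivity conditions are open, so they persist for small \<open>t\<close>. The surface is connected
  through its edges, hence \<open>x\<close> is a constant vector, and every length satisfies
  \<open>l' = x\<^sub>v l\<close> for a fixed vertex \<open>v\<close>. Thus \<open>l exp (- f\<^sub>v)\<close> is constant, and the scaling
  factor is \<open>exp (f\<^sub>v(t) - f\<^sub>v(0))\<close>.
\<close>

section \<open>Planar layouts of a triangle and its center\<close>

definition twice_area :: "('v \<Rightarrow> real) \<Rightarrow> ('v \<Rightarrow> real) \<Rightarrow> 'v \<Rightarrow> 'v \<Rightarrow> 'v \<Rightarrow> real" where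
  "twice_area X Y a b e = (X b - X a) * (Y e - Y a) - (Y b - Y a) * (X e - X a)"

text \<open>
  A placement of the vertices \<open>v\<close> of a triangle at the points \<open>(X v, Y v)\<close>, together with its center
  \<open>(u, w)\<close>. The condition on \<open>d\<close> is the projection property of the center, multiplied by the length
  of the side to keep it polynomial. Since the conditions refer to the vertex set only, one layout serves
  all orderings of the vertices.
\<close>

definition centered_layout ::
  "('v \<Rightarrow> 'v \<Rightarrow> real) \<Rightarrow> 'v set \<Rightarrow> ('v \<Rightarrow> real) \<Rightarrow> ('v \<Rightarrow> real) \<Rightarrow> real \<Rightarrow> real \<Rightarrow> bool" where
  "centered_layout d \<sigma> X Y u w \<longleftrightarrow>
     (\<forall>a\<in>\<sigma>. \<forall>b\<in>\<sigma>. a \<noteq> b \<longrightarrow>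
        0 < len d a b \<and> (len d a b)\<^sup>2 = (X b - X a)\<^sup>2 + (Y b - Y a)\<^sup>2 \<and>
        d a b * len d a b = (u - X a) * (X b - X a) + (w - Y a) * (Y b - Y a) \<and>
        (\<forall>e\<in>\<sigma>. e \<noteq> a \<and> e \<noteq> b \<longrightarrow> twice_area X Y a b e \<noteq> 0))"

lemma centered_layoutD:
  assumes "centered_layout d \<sigma> X Y u w" "a \<in> \<sigma>" "b \<in> \<sigma>" "a \<noteq> b"
  shows "0 < len d a b"
    and "(len d a b)\<^sup>2 = (X b - X a)\<^sup>2 + (Y b - Y a)\<^sup>2"
    and "d a b * len d a b = (u - X a) * (X b - X a) + (w - Y a) * (Y b - Y a)"
    and "\<lbrakk>e \<in> \<sigma>; e \<noteq> a; e \<noteq> b\<rbrakk> \<Longrightarrow> twice_area X Y a b e \<noteq> 0"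
  using assms unfolding centered_layout_def by simp_all

lemma len_commute: "len d a b = len d b a"
  by (simp add: len_def)

text \<open>
  The last claim is the strict Cauchy--Schwarz inequality for the two sides at \<open>p i\<close>, which are not
  parallel by affine independence. It is the form of the triangle inequality from which a planar copy of
  the triangle is built.
\<close>

lemma realizes_triangle:
  fixes p :: "'v \<Rightarrow> 'e::euclidean_space"
  assumes "realizes l {i, j, k} p" "i \<noteq> j" "j \<noteq> k" "i \<noteq> k"
  shows "l i j = norm (p j - p i)" "l i k = norm (p k - p i)" "l j k = norm (p k - p j)"
    and "0 < l i j" "0 < l i k" "0 < l j k"
    and "(p j - p i) \<bullet> (p k - p i) = ((l i j)\<^sup>2 + (l i k)\<^sup>2 - (l j k)\<^sup>2) / 2"
    and "((l i j)\<^sup>2 + (l i k)\<^sup>2 - (l j k)\<^sup>2)\<^sup>2 < 4 * (l i j)\<^sup>2 * (l i k)\<^sup>2"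
proof -
  have inj: "p i \<noteq> p j" "p j \<noteq> p k" "p i \<noteq> p k"
    and indep: "\<not> affine_dependent {p i, p j, p k}"
    and dist: "dist (p i) (p j) = l i j" "dist (p i) (p k) = l i k" "dist (p j) (p k) = l j k"
    using assms unfolding realizes_def by (auto simp: inj_on_def)
  show l: "l i j = norm (p j - p i)" "l i k = norm (p k - p i)" "l j k = norm (p k - p j)"
    using dist by (metis dist_commute dist_norm)+
  show "0 < l i j" "0 < l i k" "0 < l j k"
    using inj l by auto
  have diff: "p k - p j = (p k - p i) - (p j - p i)" by simp
  show inner: "(p j - p i) \<bullet> (p k - p i) = ((l i j)\<^sup>2 + (l i k)\<^sup>2 - (l j k)\<^sup>2) / 2"
    unfolding l diff by (simp add: power2_norm_eq_inner inner_diff_left inner_diff_right inner_commute)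
  have "\<not> collinear {p j, p i, p k}"
    using collinear_3_eq_affine_dependent[of "p i" "p j" "p k"] inj indep
    by (simp add: insert_commute)
  then have "\<not> collinear {0, p j - p i, p k - p i}"
    using collinear_3[of "p j" "p i" "p k"] by simp
  then have "\<bar>(p j - p i) \<bullet> (p k - p i)\<bar> < norm (p j - p i) * norm (p k - p i)"
    using norm_cauchy_schwarz_equal[of "p j - p i" "p k - p i"]
      Cauchy_Schwarz_ineq2[of "p j - p i" "p k - p i"] by linarith
  then have "\<bar>(p j - p i) \<bullet> (p k - p i)\<bar>\<^sup>2 < (norm (p j - p i) * norm (p k - p i))\<^sup>2"
    by (intro power_strict_mono) auto
  then show "((l i j)\<^sup>2 + (l i k)\<^sup>2 - (l j k)\<^sup>2)\<^sup>2 < 4 * (l i j)\<^sup>2 * (l i k)\<^sup>2"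
    unfolding inner l by (simp add: power_mult_distrib power_divide)
qed

text \<open>
  The first vertex is put at the origin and the second one on the positive first axis. The projections to
  the two sides at the first vertex determine the center; that it also projects correctly to the third
  side is exactly the balance condition in the definition of a metric.
\<close>

lemma pf_metric_centered_layout:
  assumes "pf_metric T d" "is_triangle T i j k"
  shows "\<exists>X Y u w. centered_layout d {i, j, k} X Y u w"
proof -
  have ne: "i \<noteq> j" "j \<noteq> k" "i \<noteq> k" "j \<noteq> i" "k \<noteq> j" "k \<noteq> i" and T: "{i, j, k} \<in> T"
    using assms(2) by (auto simp: is_triangle_def)
  obtain p :: "'a \<Rightarrow> real ^ 'a" where p: "realizes (len d) {i, j, k} p"
    using assms(1) T unfolding pf_metric_def piecewise_flat_def by blast
  define a b c where "a = len d i j" and "b = len d i k" and "c = len d j k"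
  have pos: "a > 0" "b > 0" "c > 0" and gram: "(a\<^sup>2 + b\<^sup>2 - c\<^sup>2)\<^sup>2 < 4 * a\<^sup>2 * b\<^sup>2"
    using realizes_triangle[OF p ne(1-3)] by (simp_all add: a_def b_def c_def)
  have balance: "(d i j)\<^sup>2 + (d j k)\<^sup>2 + (d k i)\<^sup>2 = (d j i)\<^sup>2 + (d i k)\<^sup>2 + (d k j)\<^sup>2"
    using assms unfolding pf_metric_def by blast
  \<comment> \<open>The vertices go to \<open>(0, 0)\<close>, \<open>(a, 0)\<close>, \<open>(x, y)\<close> and the center to \<open>(d i j, w)\<close>.\<close>
  define x where "x = (a\<^sup>2 + b\<^sup>2 - c\<^sup>2) / (2 * a)"
  define y where "y = sqrt (b\<^sup>2 - x\<^sup>2)"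
  define w where "w = (d i k * b - d i j * x) / y"
  have "x\<^sup>2 < b\<^sup>2"
    using gram pos by (simp add: x_def power_divide power_mult_distrib divide_simps mult.commute mult.left_commute)
  then have y: "y > 0" "y\<^sup>2 = b\<^sup>2 - x\<^sup>2"
    by (simp_all add: y_def)
  have xa: "2 * a * x = a\<^sup>2 + b\<^sup>2 - c\<^sup>2"
    using pos by (simp add: x_def)
  have b2: "b\<^sup>2 = x\<^sup>2 + y\<^sup>2" using y by simp
  have c2: "c\<^sup>2 = (x - a)\<^sup>2 + y\<^sup>2" using xa b2 by (simp add: power2_eq_square algebra_simps)
  have dik: "d i k * b = d i j * x + w * y"
    using y by (simp add: w_def)
  have dji: "d j i = a - d i j" and dki: "d k i = b - d i k" and dkj: "d k j = c - d j k"
    by (simp_all add: a_def b_def c_def len_def)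
  have djk: "d j k * c = (d i j - a) * (x - a) + w * y"
  proof -
    \<comment> \<open>This is \<open>2 c d\<^sub>j\<^sub>k = c\<^sup>2 + d\<^sub>j\<^sub>k\<^sup>2 - d\<^sub>k\<^sub>j\<^sup>2\<close>, where the balance condition gives the last difference.\<close>
    have "2 * c * d j k = c\<^sup>2 + a\<^sup>2 - 2 * a * d i j - b\<^sup>2 + 2 * b * d i k"
      using balance unfolding dji dki dkj by (simp add: power2_eq_square algebra_simps)
    then show ?thesis
      using xa dik by (simp add: power2_eq_square algebra_simps)
  qed
  have dki': "d k i * b = (x - d i j) * x + (y - w) * y"
    unfolding dki using b2 dik by (simp add: power2_eq_square algebra_simps)
  have dkj': "d k j * c = (x - d i j) * (x - a) + (y - w) * y"
    unfolding dkj using c2 djk by (simp add: power2_eq_square algebra_simps)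
  define X where "X = (\<lambda>v. if v = i then 0 else if v = j then a else x)"
  define Y where "Y = (\<lambda>v. if v = k then y else 0)"
  have XY: "X i = 0" "X j = a" "X k = x" "Y i = 0" "Y j = 0" "Y k = y"
    using ne by (simp_all add: X_def Y_def)
  have lens: "len d i j = a" "len d j i = a" "len d i k = b" "len d k i = b" "len d j k = c" "len d k j = c"
    by (simp_all add: a_def b_def c_def len_def)
  have "centered_layout d {i, j, k} X Y (d i j) w"
    unfolding centered_layout_def
    using ne pos y(1) dik djk dki' dkj'
    by (auto simp: twice_area_def XY lens b2 c2 dji power2_commute algebra_simps)
  then show ?thesis by blast
qed

section \<open>Angles, edge weights and their first variation\<close>

lemma inner_2: "(x :: real ^ 2) \<bullet> y = x $ 1 * y $ 1 + x $ 2 * y $ 2"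
  by (simp add: inner_vec_def sum_2)

lemma centered_layout_realizes:
  assumes lay: "centered_layout d {i, j, k} X Y u w" and ne: "i \<noteq> j" "j \<noteq> k" "i \<noteq> k"
  shows "realizes (len d) {i, j, k} (\<lambda>v. vector [X v, Y v] :: real ^ 2)"
proof -
  let ?p = "\<lambda>v. vector [X v, Y v] :: real ^ 2"
  have dist: "dist (?p a) (?p b) = len d a b" if  "a \<in> {i, j, k}" "b \<in> {i, j, k}" "a \<noteq> b" for a b
  proof -
    have "(dist (?p a) (?p b))\<^sup>2 = (X b - X a)\<^sup>2 + (Y b - Y a)\<^sup>2"
      unfolding dist_norm power2_norm_eq_inner inner_2
      by (simp add: power2_eq_square algebra_simps)
    then have "(dist (?p a) (?p b))\<^sup>2 = (len d a b)\<^sup>2" and "0 < len d a b"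
      using centered_layoutD(1,2)[OF lay that] by simp_all
    then show ?thesis by (simp add: power2_eq_iff_nonneg)
  qed
  have pos: "0 < len d a b" if "a \<in> {i, j, k}" "b \<in> {i, j, k}" "a \<noteq> b" for a b
    using centered_layoutD(1)[OF lay that] .
  have inj: "inj_on ?p {i, j, k}"
  proof (rule inj_onI)
    fix a b assume "a \<in> {i, j, k}" "b \<in> {i, j, k}" "?p a = ?p b"
    then show "a = b"
      using dist[of a b] pos[of a b] by fastforce
  qed
  have "twice_area X Y i j k \<noteq> 0"
    using centered_layoutD(4)[OF lay, of i j k] ne by simp
  then have "\<not> collinear {0, ?p j - ?p i, ?p k - ?p i}"
    unfolding collinear_lemma by (auto simp: vec_eq_iff forall_2 twice_area_def)
  then have "\<not> collinear {?p j, ?p i, ?p k}"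
    using collinear_3[of "?p j" "?p i" "?p k"] by simp
  then have "\<not> affine_dependent (?p ` {i, j, k})"
    using collinear_3_eq_affine_dependent[of "?p j" "?p i" "?p k"] by (simp add: insert_commute)
  then show ?thesis
    unfolding realizes_def using inj dist by auto
qed

definition law_of_cosines :: "real \<Rightarrow> real \<Rightarrow> real \<Rightarrow> real" where
  "law_of_cosines a b c = (a\<^sup>2 + b\<^sup>2 - c\<^sup>2) / (2 * a * b)"

lemma tri_angle_eq_arccos:
  assumes "centered_layout d {i, j, k} X Y u w" and ne: "i \<noteq> j" "j \<noteq> k" "i \<noteq> k"
  shows "tri_angle (len d) i j k = arccos (law_of_cosines (len d i j) (len d i k) (len d j k))"
  unfolding tri_angle_def
proof (rule the_equality)
  have *: "((p j - p i) \<bullet> (p k - p i)) / (norm (p j - p i) * norm (p k - p i))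
      = law_of_cosines (len d i j) (len d i k) (len d j k)"
    if "realizes (len d) {i, j, k} p" for p :: "'a \<Rightarrow> real ^ 2"
    unfolding realizes_triangle(7)[OF that ne] law_of_cosines_def
    unfolding realizes_triangle(1,2)[OF that ne, symmetric] by simp
  show "\<exists>p :: 'a \<Rightarrow> real ^ 2. realizes (len d) {i, j, k} p \<and>
      arccos (law_of_cosines (len d i j) (len d i k) (len d j k)) =
      arccos (((p j - p i) \<bullet> (p k - p i)) / (norm (p j - p i) * norm (p k - p i)))"
    using centered_layout_realizes[OF assms] * by metis
  show "\<theta> = arccos (law_of_cosines (len d i j) (len d i k) (len d j k))"
    if "\<exists>p :: 'a \<Rightarrow> real ^ 2. realizes (len d) {i, j, k} p \<and>
      \<theta> = arccos (((p j - p i) \<bullet> (p k - p i)) / (norm (p j - p i) * norm (p k - p i)))" for \<theta>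
    using that * by metis
qed

text \<open>
  The identity for \<open>sqrt (1 - C\<^sup>2)\<close>, which is the sine of the angle, is Lagrange's identity
  for the two sides at \<open>i\<close>.
\<close>

lemma law_of_cosines_layout:
  assumes lay: "centered_layout d {i, j, k} X Y u w" and ne: "i \<noteq> j" "j \<noteq> k" "i \<noteq> k"
  defines "C \<equiv> law_of_cosines (len d i j) (len d i k) (len d j k)"
  shows "C * len d i j * len d i k = (X j - X i) * (X k - X i) + (Y j - Y i) * (Y k - Y i)"
    and "-1 < C" and "C < 1"
    and "sqrt (1 - C\<^sup>2) = \<bar>twice_area X Y i j k\<bar> / (len d i j * len d i k)"
proof -
  let ?a = "len d i j" and ?b = "len d i k" and ?c = "len d j k"
  have pos: "0 < ?a" "0 < ?b"
    and sq: "?a\<^sup>2 = (X j - X i)\<^sup>2 + (Y j - Y i)\<^sup>2" "?b\<^sup>2 = (X k - X i)\<^sup>2 + (Y k - Y i)\<^sup>2"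
      "?c\<^sup>2 = (X k - X j)\<^sup>2 + (Y k - Y j)\<^sup>2"
    and D: "twice_area X Y i j k \<noteq> 0"
    using centered_layoutD[OF lay, of i j] centered_layoutD[OF lay, of i k]
      centered_layoutD[OF lay, of j k] ne by auto
  have "C * ?a * ?b = (?a\<^sup>2 + ?b\<^sup>2 - ?c\<^sup>2) / 2"
    using pos by (simp add: C_def law_of_cosines_def)
  also have "\<dots> = (X j - X i) * (X k - X i) + (Y j - Y i) * (Y k - Y i)"
    unfolding sq by (simp add: power2_eq_square field_simps)
  finally show C: "C * ?a * ?b = (X j - X i) * (X k - X i) + (Y j - Y i) * (Y k - Y i)" .
  have "(1 - C\<^sup>2) * (?a\<^sup>2 * ?b\<^sup>2) = ?a\<^sup>2 * ?b\<^sup>2 - (C * ?a * ?b)\<^sup>2"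
    by (simp add: power_mult_distrib algebra_simps)
  also have "\<dots> = (twice_area X Y i j k)\<^sup>2"
    unfolding sq C twice_area_def by (simp add: power2_eq_square algebra_simps)
  finally have S: "1 - C\<^sup>2 = (twice_area X Y i j k / (?a * ?b))\<^sup>2"
    using pos by (simp add: field_simps power_mult_distrib)
  then have "0 < 1 - C\<^sup>2"
    using D pos by simp
  then have "\<bar>C\<bar> < 1"
    by (simp add: abs_square_less_1)
  then show "-1 < C" "C < 1" by auto
  show "sqrt (1 - C\<^sup>2) = \<bar>twice_area X Y i j k\<bar> / (?a * ?b)"
    unfolding S using pos by (simp add: abs_mult)
qed

text \<open>
  For the perpendicular bisector structure, whose centers are circumcenters, this is half of the cotangent
  of the opposite angle.
\<close>

definition edge_weight :: "('v \<Rightarrow> 'v \<Rightarrow> real) \<Rightarrow> 'v \<Rightarrow> 'v \<Rightarrow> 'v \<Rightarrow> real" where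
  "edge_weight d i j k = height d i j k / len d i j"

text \<open>
  The quotient of the two factors \<open>twice_area X Y i j k\<close> and its absolute value is the orientation of
  the layout; the remaining factor is twice the signed area spanned by the edge and the center.
\<close>

lemma edge_weight_layout:
  assumes lay: "centered_layout d {i, j, k} X Y u w" and ne: "i \<noteq> j" "j \<noteq> k" "i \<noteq> k"
  shows "edge_weight d i j k =
    twice_area X Y i j k * ((X j - X i) * (w - Y i) - (Y j - Y i) * (u - X i)) /
    ((len d i j)\<^sup>2 * \<bar>twice_area X Y i j k\<bar>)"
proof -
  let ?a = "len d i j" and ?b = "len d i k" and ?c = "len d j k" and ?D = "\<bar>twice_area X Y i j k\<bar>"
  define C where "C = law_of_cosines ?a ?b ?c"
  note loc = law_of_cosines_layout[OF assms, folded C_def]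
  have pos: "0 < ?a" "0 < ?b"
    and sq: "?a\<^sup>2 = (X j - X i)\<^sup>2 + (Y j - Y i)\<^sup>2"
    and dl: "d i j * ?a = (u - X i) * (X j - X i) + (w - Y i) * (Y j - Y i)"
      "d i k * ?b = (u - X i) * (X k - X i) + (w - Y i) * (Y k - Y i)"
    and D: "?D > 0"
    using centered_layoutD[OF lay, of i j] centered_layoutD[OF lay, of i k]
      centered_layoutD[OF lay, of j k] ne by auto
  have ang: "tri_angle (len d) i j k = arccos C"
    using tri_angle_eq_arccos[OF assms] by (simp add: C_def)
  have "height d i j k = (d i k - d i j * C) / (?D / (?a * ?b))"
    unfolding height_def ang using loc by (simp add: cos_arccos sin_arccos)
  also have "\<dots> = (d i k * ?b * ?a\<^sup>2 - (d i j * ?a) * (C * ?a * ?b)) / (?D * ?a)"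
    using pos D by (simp add: field_simps power2_eq_square)
  also have "d i k * ?b * ?a\<^sup>2 - (d i j * ?a) * (C * ?a * ?b) =
      twice_area X Y i j k * ((X j - X i) * (w - Y i) - (Y j - Y i) * (u - X i))"
    unfolding sq dl loc(1) twice_area_def by (simp add: power2_eq_square algebra_simps)
  finally show ?thesis
    unfolding edge_weight_def by (simp add: power2_eq_square mult.assoc mult.commute)
qed

text \<open>
  The height is defined from the angle at the first vertex only. That the second vertex gives the same
  value expresses that both describe the distance of the edge from one and the same center.
\<close>

lemma edge_weight_commute:
  assumes lay: "centered_layout d {i, j, k} X Y u w" and ne: "i \<noteq> j" "j \<noteq> k" "i \<noteq> k"
  shows "edge_weight d i j k = edge_weight d j i k"
proof -
  have lay': "centered_layout d {j, i, k} X Y u w"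
    using lay by (simp add: insert_commute)
  have flip: "twice_area X Y j i k = - twice_area X Y i j k"
    by (simp add: twice_area_def algebra_simps)
  have num: "(X i - X j) * (w - Y j) - (Y i - Y j) * (u - X j) =
      - ((X j - X i) * (w - Y i) - (Y j - Y i) * (u - X i))"
    by (simp add: algebra_simps)
  show ?thesis
    unfolding edge_weight_layout[OF lay ne] edge_weight_layout[OF lay' ne(1)[symmetric] ne(3,2)]
    by (simp only: num flip len_commute[of d j i] minus_mult_minus abs_minus_cancel)
qed

text \<open>
  The polynomial identity behind the variation of an angle. The vertices are the origin, \<open>(p, q)\<close> and
  \<open>(r, s)\<close>, the center is \<open>(e, h)\<close>, and \<open>aa\<close>, \<open>bb\<close>, \<open>cc\<close> are half of the derivatives of the squared
  side lengths.
\<close>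

lemma angle_derivative_identity:
  fixes p q r s e h xi xj xk :: real
  defines "A \<equiv> p\<^sup>2 + q\<^sup>2" and "B \<equiv> r\<^sup>2 + s\<^sup>2" and "D \<equiv> p * s - q * r"
    and "aa \<equiv> (e * p + h * q) * xi + ((e - p) * (- p) + (h - q) * (- q)) * xj"
    and "bb \<equiv> (e * r + h * s) * xi + ((e - r) * (- r) + (h - s) * (- s)) * xk"
    and "cc \<equiv> ((e - p) * (r - p) + (h - q) * (s - q)) * xj + ((e - r) * (p - r) + (h - s) * (q - s)) * xk"
  shows "- ((aa + bb - cc) * A * B - (p * r + q * s) * (aa * B + bb * A)) =
    D * (p * h - q * e) * (xj - xi) * B - D * (r * h - s * e) * (xk - xi) * A"
  unfolding assms by algebra

text \<open>
  A variation with \<open>l\<^sub>a\<^sub>b' = d\<^sub>a\<^sub>b x\<^sub>a + d\<^sub>b\<^sub>a x\<^sub>b\<close> changes angles by a Laplacian of \<open>x\<close>: the derivative of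
  the law of cosines only involves the products \<open>l l'\<close>, and these are polynomials in the coordinates
  of the layout and its center.
\<close>

lemma tri_angle_has_derivative:
  fixes d :: "real \<Rightarrow> 'v \<Rightarrow> 'v \<Rightarrow> real"
  assumes lay: "centered_layout (d t) {i, j, k} X Y u w" and ne: "i \<noteq> j" "j \<noteq> k" "i \<noteq> k"
    and nbhd: "open S" "t \<in> S" "\<And>s. s \<in> S \<Longrightarrow> \<exists>X Y u w. centered_layout (d s) {i, j, k} X Y u w"
    and deriv: "\<And>a b. a \<in> {i, j, k} \<Longrightarrow> b \<in> {i, j, k} \<Longrightarrow> a \<noteq> b \<Longrightarrow>
      ((\<lambda>s. len (d s) a b) has_real_derivative d t a b * x a + d t b a * x b) (at t)"
  shows "((\<lambda>s. tri_angle (len (d s)) i j k) has_real_derivative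
    edge_weight (d t) i j k * (x j - x i) + edge_weight (d t) i k j * (x k - x i)) (at t)"
proof -
  let ?a = "\<lambda>s. len (d s) i j" and ?b = "\<lambda>s. len (d s) i k" and ?c = "\<lambda>s. len (d s) j k"
  let ?e = "d t" and ?D = "twice_area X Y i j k"
  define C where "C = (\<lambda>s. law_of_cosines (?a s) (?b s) (?c s))"
  note loc = law_of_cosines_layout[OF lay ne]
  have loc: "C t * ?a t * ?b t = (X j - X i) * (X k - X i) + (Y j - Y i) * (Y k - Y i)"
    "-1 < C t" "C t < 1" "sqrt (1 - (C t)\<^sup>2) = \<bar>?D\<bar> / (?a t * ?b t)"
    using loc by (simp_all add: C_def)
  have pos: "0 < ?a t" "0 < ?b t" "0 < ?c t"
    and sq: "(?a t)\<^sup>2 = (X j - X i)\<^sup>2 + (Y j - Y i)\<^sup>2" "(?b t)\<^sup>2 = (X k - X i)\<^sup>2 + (Y k - Y i)\<^sup>2"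
    and D: "?D \<noteq> 0"
    using centered_layoutD[OF lay, of i j] centered_layoutD[OF lay, of i k]
      centered_layoutD[OF lay, of j k] ne by auto
  have dl: "?e p q * len ?e p q = (u - X p) * (X q - X p) + (w - Y p) * (Y q - Y p)"
    if "p \<in> {i, j, k}" "q \<in> {i, j, k}" "p \<noteq> q" for p q
    using centered_layoutD(3)[OF lay that] .
  define a' b' c' where "a' = ?e i j * x i + ?e j i * x j"
    and "b' = ?e i k * x i + ?e k i * x k" and "c' = ?e j k * x j + ?e k j * x k"
  have prods: "?a t * a' = ((u - X i) * (X j - X i) + (w - Y i) * (Y j - Y i)) * x i
        + ((u - X j) * (X i - X j) + (w - Y j) * (Y i - Y j)) * x j"
    "?b t * b' = ((u - X i) * (X k - X i) + (w - Y i) * (Y k - Y i)) * x i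
        + ((u - X k) * (X i - X k) + (w - Y k) * (Y i - Y k)) * x k"
    "?c t * c' = ((u - X j) * (X k - X j) + (w - Y j) * (Y k - Y j)) * x j
        + ((u - X k) * (X j - X k) + (w - Y k) * (Y j - Y k)) * x k"
  proof -
    have "?a t * a' = ?e i j * len ?e i j * x i + ?e j i * len ?e j i * x j"
      "?b t * b' = ?e i k * len ?e i k * x i + ?e k i * len ?e k i * x k"
      "?c t * c' = ?e j k * len ?e j k * x j + ?e k j * len ?e k j * x k"
      unfolding a'_def b'_def c'_def len_commute[of ?e j i] len_commute[of ?e k i] len_commute[of ?e k j]
      by (simp_all only: distrib_left mult.assoc mult.commute mult.left_commute)
    then show "?a t * a' = ((u - X i) * (X j - X i) + (w - Y i) * (Y j - Y i)) * x i
        + ((u - X j) * (X i - X j) + (w - Y j) * (Y i - Y j)) * x j"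
    "?b t * b' = ((u - X i) * (X k - X i) + (w - Y i) * (Y k - Y i)) * x i
        + ((u - X k) * (X i - X k) + (w - Y k) * (Y i - Y k)) * x k"
    "?c t * c' = ((u - X j) * (X k - X j) + (w - Y j) * (Y k - Y j)) * x j
        + ((u - X k) * (X j - X k) + (w - Y k) * (Y j - Y k)) * x k"
      using dl[of i j] dl[of j i] dl[of i k] dl[of k i] dl[of j k] dl[of k j] ne by auto
  qed
  have Da: "(?a has_real_derivative a') (at t)" and Db: "(?b has_real_derivative b') (at t)"
    and Dc: "(?c has_real_derivative c') (at t)"
    using deriv ne by (auto simp: a'_def b'_def c'_def)
  define N' where "N' = ?a t * a' + ?b t * b' - ?c t * c'"
  define g where "g = (N' - C t * (a' * ?b t + ?a t * b')) / (?a t * ?b t)"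
  have DC: "(C has_real_derivative g) (at t)"
  proof -
    have "((\<lambda>s. ((?a s)\<^sup>2 + (?b s)\<^sup>2 - (?c s)\<^sup>2) / (2 * ?a s * ?b s)) has_real_derivative
        ((2 * N') * (2 * ?a t * ?b t) - ((?a t)\<^sup>2 + (?b t)\<^sup>2 - (?c t)\<^sup>2) * (2 * (a' * ?b t + ?a t * b'))) /
        ((2 * ?a t * ?b t) * (2 * ?a t * ?b t))) (at t)"
      using pos by (auto intro!: derivative_eq_intros Da Db Dc simp: N'_def algebra_simps)
    moreover have "((2 * N') * (2 * ?a t * ?b t) - ((?a t)\<^sup>2 + (?b t)\<^sup>2 - (?c t)\<^sup>2) * (2 * (a' * ?b t + ?a t * b'))) /
        ((2 * ?a t * ?b t) * (2 * ?a t * ?b t)) = g"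
      using pos unfolding g_def C_def law_of_cosines_def by (simp add: field_simps)
    ultimately show ?thesis
      unfolding C_def law_of_cosines_def by simp
  qed
  have "((\<lambda>s. arccos (C s)) has_real_derivative - g / sqrt (1 - (C t)\<^sup>2)) (at t)"
    using DERIV_chain2[OF DERIV_arccos[OF loc(2,3)] DC] by (simp add: field_simps)
  moreover have "- g / sqrt (1 - (C t)\<^sup>2) =
      edge_weight (d t) i j k * (x j - x i) + edge_weight (d t) i k j * (x k - x i)"
  proof -
    have lay': "centered_layout (d t) {i, k, j} X Y u w"
      using lay by (simp add: insert_commute)
    have flip: "twice_area X Y i k j = - ?D"
      by (simp add: twice_area_def algebra_simps)
    define A2 B2 where "A2 = (X j - X i)\<^sup>2 + (Y j - Y i)\<^sup>2" and "B2 = (X k - X i)\<^sup>2 + (Y k - Y i)\<^sup>2"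
    have AB: "(?a t)\<^sup>2 = A2" "(?b t)\<^sup>2 = B2"
      using sq by (simp_all add: A2_def B2_def)
    have AB0: "A2 > 0" "B2 > 0"
      unfolding AB[symmetric] using pos by simp_all
    define G where "G = N' * A2 * B2 - ((X j - X i) * (X k - X i) + (Y j - Y i) * (Y k - Y i)) *
          ((?a t * a') * B2 + (?b t * b') * A2)"
    have "g * (?a t * ?b t) * (A2 * B2) = N' * A2 * B2 - (C t * ?a t * ?b t) *
          ((?a t * a') * B2 + (?b t * b') * A2)"
      unfolding g_def AB[symmetric] using pos by (simp add: field_simps power2_eq_square)
    then have "g * (?a t * ?b t) * (A2 * B2) = G"
      unfolding G_def loc(1) .
    then have "g * (?a t * ?b t) = G / (A2 * B2)"
      using AB0 by (simp add: eq_divide_eq)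
    then have "- g / sqrt (1 - (C t)\<^sup>2) = - G / (A2 * B2 * \<bar>?D\<bar>)"
      unfolding loc(4) by (simp add: mult.commute)
    also have "- G = ?D * ((X j - X i) * (w - Y i) - (Y j - Y i) * (u - X i)) * (x j - x i) * B2
        - ?D * ((X k - X i) * (w - Y i) - (Y k - Y i) * (u - X i)) * (x k - x i) * A2"
    proof -
      have rel: "X k - X j = (X k - X i) - (X j - X i)" "Y k - Y j = (Y k - Y i) - (Y j - Y i)"
        "X j - X k = (X j - X i) - (X k - X i)" "Y j - Y k = (Y j - Y i) - (Y k - Y i)"
        "X i - X j = - (X j - X i)" "Y i - Y j = - (Y j - Y i)"
        "X i - X k = - (X k - X i)" "Y i - Y k = - (Y k - Y i)"
        "u - X j = (u - X i) - (X j - X i)" "w - Y j = (w - Y i) - (Y j - Y i)"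
        "u - X k = (u - X i) - (X k - X i)" "w - Y k = (w - Y i) - (Y k - Y i)"
        by simp_all
      show ?thesis
        unfolding G_def N'_def prods A2_def B2_def twice_area_def unfolding rel
        by (rule angle_derivative_identity)
    qed
    also have "\<dots> / (A2 * B2 * \<bar>?D\<bar>) =
        ?D * ((X j - X i) * (w - Y i) - (Y j - Y i) * (u - X i)) / (A2 * \<bar>?D\<bar>) * (x j - x i)
        + (- ?D) * ((X k - X i) * (w - Y i) - (Y k - Y i) * (u - X i)) / (B2 * \<bar>?D\<bar>) * (x k - x i)"
      using AB0 D by (simp add: field_simps)
    finally show ?thesis
      using edge_weight_layout[OF lay ne] edge_weight_layout[OF lay'] ne
      by (simp add: AB flip)
  qed
  ultimately have "((\<lambda>s. arccos (C s)) has_real_derivative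
      edge_weight (d t) i j k * (x j - x i) + edge_weight (d t) i k j * (x k - x i)) (at t)"
    by simp
  then show ?thesis
  proof (rule has_field_derivative_transform_within_open[OF _ nbhd(1,2)])
    show "arccos (C s) = tri_angle (len (d s)) i j k" if "s \<in> S" for s
      using nbhd(3)[OF that] tri_angle_eq_arccos ne by (metis C_def)
  qed
qed

section \<open>The quadratic form of one triangle\<close>

text \<open>
  In the same coordinates, \<open>nij\<close>, \<open>njk\<close>, \<open>nki\<close> are twice the signed areas spanned by the center and the
  sides, and \<open>B\<close>, \<open>A\<close>, \<open>C\<close> are the squared lengths of the sides missing from the products in front of
  them. The factors on the right are the products \<open>d l\<close> for the six directed edges.
\<close>

lemma weight_product_identity:
  fixes p q r s e h :: real
  defines "A \<equiv> p\<^sup>2 + q\<^sup>2" and "B \<equiv> r\<^sup>2 + s\<^sup>2" and "C \<equiv> (r - p)\<^sup>2 + (s - q)\<^sup>2"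
    and "nij \<equiv> p * h - q * e"
    and "njk \<equiv> (r - p) * (h - q) - (s - q) * (e - p)"
    and "nki \<equiv> (- r) * (h - s) - (- s) * (e - r)"
  shows "nij * njk * B + njk * nki * A + nki * nij * C =
    (e * p + h * q) * ((e - p) * (r - p) + (h - q) * (s - q)) * ((e - r) * (- r) + (h - s) * (- s))
    + ((e - p) * (- p) + (h - q) * (- q)) * ((e - r) * (p - r) + (h - s) * (q - s)) * (e * r + h * s)"
  unfolding assms by algebra

text \<open>
  The hypotheses say that \<open>(m, n)\<close> is equidistant from the three vertices, so it is the circumcenter.
  The last factor is minus the power of \<open>(e, h)\<close> with respect to the circumcircle, which passes
  through the origin.
\<close>

lemma circumcircle_power_identity:
  fixes p q r s e h m n :: real
  assumes "p\<^sup>2 + q\<^sup>2 = 2 * (p * m + q * n)" "r\<^sup>2 + s\<^sup>2 = 2 * (r * m + s * n)"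
  shows "(e * p + h * q) * ((e - p) * (r - p) + (h - q) * (s - q)) * ((e - r) * (- r) + (h - s) * (- s))
    + ((e - p) * (- p) + (h - q) * (- q)) * ((e - r) * (p - r) + (h - s) * (q - s)) * (e * r + h * s)
    = (p * s - q * r)\<^sup>2 * (2 * (e * m + h * n) - e\<^sup>2 - h\<^sup>2)"
proof -
  define A B D where "A = p\<^sup>2 + q\<^sup>2" and "B = r\<^sup>2 + s\<^sup>2" and "D = p * s - q * r"
  \<comment> \<open>Cramer's rule for the circumcenter, leaving an identity without side conditions.\<close>
  have m: "2 * (D * m) = A * s - B * q" and n: "2 * (D * n) = p * B - r * A"
    unfolding A_def B_def assms D_def by (simp_all add: algebra_simps)
  have "D\<^sup>2 * (2 * (e * m + h * n) - e\<^sup>2 - h\<^sup>2) =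
      D * (e * (2 * (D * m)) + h * (2 * (D * n))) - D\<^sup>2 * (e\<^sup>2 + h\<^sup>2)"
    by (simp add: power2_eq_square algebra_simps)
  also have "\<dots> = D * (e * (A * s - B * q) + h * (p * B - r * A)) - D\<^sup>2 * (e\<^sup>2 + h\<^sup>2)"
    unfolding m n ..
  also have "\<dots> = (e * p + h * q) * ((e - p) * (r - p) + (h - q) * (s - q)) * ((e - r) * (- r) + (h - s) * (- s))
    + ((e - p) * (- p) + (h - q) * (- q)) * ((e - r) * (p - r) + (h - s) * (q - s)) * (e * r + h * s)"
    unfolding A_def B_def D_def by algebra
  finally show ?thesis by (simp add: D_def)
qed

definition triangle_form :: "('v \<Rightarrow> 'v \<Rightarrow> real) \<Rightarrow> 'v \<Rightarrow> 'v \<Rightarrow> 'v \<Rightarrow> ('v \<Rightarrow> real) \<Rightarrow> real" where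
  "triangle_form d i j k x =
     edge_weight d i j k * (x j - x i)\<^sup>2 + edge_weight d j k i * (x k - x j)\<^sup>2 +
     edge_weight d k i j * (x i - x k)\<^sup>2"

text \<open>
  Dividing each \<open>d a b\<close> by the length of its side turns this into \<open>x y z + (1 - x) (1 - y) (1 - z)\<close>,
  Routh's formula for the area of the triangle of the three projections of the center (the pedal
  triangle) relative to the area of the whole triangle. With a minus sign in the middle it would be the
  expression whose vanishing is Ceva's condition.
\<close>

definition ceva_sum :: "('v \<Rightarrow> 'v \<Rightarrow> real) \<Rightarrow> 'v \<Rightarrow> 'v \<Rightarrow> 'v \<Rightarrow> real" where
  "ceva_sum d i j k = d i j * d j k * d k i + d j i * d k j * d i k"

text \<open>
  The two invariants that decide the definiteness of \<open>triangle_form\<close>: its determinant modulo constants,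
  and the value that fixes its sign. The latter is the sum of the products (height times side), which is
  twice the area of the triangle.
\<close>

lemma edge_weights_layout:
  assumes lay: "centered_layout d {i, j, k} X Y u w" and ne: "i \<noteq> j" "j \<noteq> k" "i \<noteq> k"
  shows "edge_weight d i j k * edge_weight d j k i + edge_weight d j k i * edge_weight d k i j +
      edge_weight d k i j * edge_weight d i j k =
      ceva_sum d i j k / (len d i j * len d j k * len d k i)"
    and "edge_weight d i j k * (len d i j)\<^sup>2 + edge_weight d j k i * (len d j k)\<^sup>2 +
      edge_weight d k i j * (len d k i)\<^sup>2 > 0"
proof -
  let ?a = "len d i j" and ?b = "len d k i" and ?c = "len d j k"
  define D where "D = twice_area X Y i j k"
  define n where "n = (\<lambda>p q. (X q - X p) * (w - Y p) - (Y q - Y p) * (u - X p))"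
  \<comment> \<open>The orientation of the layout: squared in the products of two weights, and turning the signed
    area into the area in the sum.\<close>
  define e where "e = sgn D"
  have D0: "D \<noteq> 0" and pos: "?a > 0" "?b > 0" "?c > 0"
    using centered_layoutD[OF lay, of i j] centered_layoutD[OF lay, of j k]
      centered_layoutD[OF lay, of k i] ne by (auto simp: D_def)
  have lay': "centered_layout d {j, k, i} X Y u w" "centered_layout d {k, i, j} X Y u w"
    using lay by (simp_all add: insert_commute)
  have cyc: "twice_area X Y j k i = D" "twice_area X Y k i j = D"
    unfolding D_def twice_area_def by (simp_all add: algebra_simps)
  have De: "D / \<bar>D\<bar> = e"
    by (simp add: e_def real_sgn_eq)
  have e2: "e * e = 1" and eD: "e * D = \<bar>D\<bar>"
    using D0 by (auto simp: e_def sgn_if)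
  have aux: "D * t / (l * \<bar>D\<bar>) = e * t / l" for t l
    unfolding De[symmetric] by simp
  have W: "edge_weight d i j k = e * n i j / ?a\<^sup>2"
    "edge_weight d j k i = e * n j k / ?c\<^sup>2"
    "edge_weight d k i j = e * n k i / ?b\<^sup>2"
    using edge_weight_layout[OF lay ne] edge_weight_layout[OF lay'(1) ne(2) ne(3)[symmetric] ne(1)[symmetric]]
      edge_weight_layout[OF lay'(2) ne(3)[symmetric] ne(1) ne(2)[symmetric]]
    unfolding cyc D_def[symmetric] n_def[symmetric] aux by (simp_all add: n_def)
  have rel: "X k - X j = (X k - X i) - (X j - X i)" "Y k - Y j = (Y k - Y i) - (Y j - Y i)"
    "X j - X k = (X j - X i) - (X k - X i)" "Y j - Y k = (Y j - Y i) - (Y k - Y i)"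
    "X i - X j = - (X j - X i)" "Y i - Y j = - (Y j - Y i)"
    "X i - X k = - (X k - X i)" "Y i - Y k = - (Y k - Y i)"
    "u - X j = (u - X i) - (X j - X i)" "w - Y j = (w - Y i) - (Y j - Y i)"
    "u - X k = (u - X i) - (X k - X i)" "w - Y k = (w - Y i) - (Y k - Y i)"
    by simp_all
  have sq: "?a\<^sup>2 = (X j - X i)\<^sup>2 + (Y j - Y i)\<^sup>2" "?b\<^sup>2 = (X k - X i)\<^sup>2 + (Y k - Y i)\<^sup>2"
    "?c\<^sup>2 = (X k - X j)\<^sup>2 + (Y k - Y j)\<^sup>2"
    using centered_layoutD(2)[OF lay, of i j] centered_layoutD(2)[OF lay, of i k]
      centered_layoutD(2)[OF lay, of j k] ne by (auto simp: len_commute[of d k i])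
  have dl: "d i j * ?a = (u - X i) * (X j - X i) + (w - Y i) * (Y j - Y i)"
    "d j k * ?c = (u - X j) * (X k - X j) + (w - Y j) * (Y k - Y j)"
    "d k i * ?b = (u - X k) * (X i - X k) + (w - Y k) * (Y i - Y k)"
    "d j i * ?a = (u - X j) * (X i - X j) + (w - Y j) * (Y i - Y j)"
    "d k j * ?c = (u - X k) * (X j - X k) + (w - Y k) * (Y j - Y k)"
    "d i k * ?b = (u - X i) * (X k - X i) + (w - Y i) * (Y k - Y i)"
    using centered_layoutD(3)[OF lay, of i j] centered_layoutD(3)[OF lay, of j k]
      centered_layoutD(3)[OF lay, of k i] centered_layoutD(3)[OF lay, of j i]
      centered_layoutD(3)[OF lay, of k j] centered_layoutD(3)[OF lay, of i k] ne
    by (auto simp: len_commute[of d j i] len_commute[of d k j] len_commute[of d i k])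
  have "n i j * n j k * ?b\<^sup>2 + n j k * n k i * ?a\<^sup>2 + n k i * n i j * ?c\<^sup>2 =
      (d i j * ?a) * (d j k * ?c) * (d k i * ?b) + (d j i * ?a) * (d k j * ?c) * (d i k * ?b)"
    unfolding dl sq n_def unfolding rel by (rule weight_product_identity)
  also have "\<dots> = ceva_sum d i j k * (?a * ?c * ?b)"
    by (simp add: ceva_sum_def algebra_simps)
  finally have P: "n i j * n j k * ?b\<^sup>2 + n j k * n k i * ?a\<^sup>2 + n k i * n i j * ?c\<^sup>2 =
    ceva_sum d i j k * (?a * ?c * ?b)" .
  have "edge_weight d i j k * edge_weight d j k i + edge_weight d j k i * edge_weight d k i j +
      edge_weight d k i j * edge_weight d i j k =
      (e * e) * (n i j * n j k * ?b\<^sup>2 + n j k * n k i * ?a\<^sup>2 + n k i * n i j * ?c\<^sup>2) / (?a\<^sup>2 * ?c\<^sup>2 * ?b\<^sup>2)"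
    unfolding W using pos by (simp add: field_simps)
  also have "\<dots> = ceva_sum d i j k / (?a * ?c * ?b)"
    unfolding P e2 using pos by (simp add: power2_eq_square)
  finally show "edge_weight d i j k * edge_weight d j k i + edge_weight d j k i * edge_weight d k i j +
      edge_weight d k i j * edge_weight d i j k =
      ceva_sum d i j k / (len d i j * len d j k * len d k i)" .
  have "edge_weight d i j k * ?a\<^sup>2 + edge_weight d j k i * ?c\<^sup>2 + edge_weight d k i j * ?b\<^sup>2 =
      e * (n i j + n j k + n k i)"
    unfolding W using pos by (simp add: algebra_simps)
  also have "n i j + n j k + n k i = D"
    unfolding n_def D_def twice_area_def by (simp add: algebra_simps)
  also have "e * D > 0"
    unfolding eD using D0 by simp
  finally show "edge_weight d i j k * (len d i j)\<^sup>2 + edge_weight d j k i * (len d j k)\<^sup>2 +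
      edge_weight d k i j * (len d k i)\<^sup>2 > 0" .
qed

text \<open>
  Completing the square shows that the form is definite modulo constants, with the sign of the
  coefficient \<open>s\<close>. The sign is positive because the form of the two coordinate functions of a layout
  adds up to the sum of the products of weights and squared lengths.
\<close>

lemma triangle_form_pos_def:
  assumes lay: "centered_layout d {i, j, k} X Y u w" and ne: "i \<noteq> j" "j \<noteq> k" "i \<noteq> k"
    and ceva: "ceva_sum d i j k > 0"
  shows "triangle_form d i j k x \<ge> 0"
    and "triangle_form d i j k x = 0 \<Longrightarrow> x i = x j"
proof -
  let ?w1 = "edge_weight d i j k" and ?w2 = "edge_weight d j k i" and ?w3 = "edge_weight d k i j"
  define s where "s = ?w1 + ?w2"
  define \<sigma> where "\<sigma> = ?w1 * ?w2 + ?w2 * ?w3 + ?w3 * ?w1"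
  have pos: "len d i j > 0" "len d k i > 0" "len d j k > 0"
    using centered_layoutD(1)[OF lay, of i j] centered_layoutD(1)[OF lay, of j k]
      centered_layoutD(1)[OF lay, of k i] ne by auto
  have \<sigma>: "\<sigma> > 0"
    unfolding \<sigma>_def edge_weights_layout(1)[OF lay ne] using pos ceva by simp
  have square: "s * triangle_form d i j k y = (s * (y j - y i) - ?w2 * (y k - y i))\<^sup>2 + \<sigma> * (y k - y i)\<^sup>2" for y
    unfolding s_def \<sigma>_def triangle_form_def by algebra
  have "triangle_form d i j k X + triangle_form d i j k Y =
      ?w1 * (len d i j)\<^sup>2 + ?w2 * (len d j k)\<^sup>2 + ?w3 * (len d k i)\<^sup>2"
    using centered_layoutD(2)[OF lay, of i j] centered_layoutD(2)[OF lay, of j k]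
      centered_layoutD(2)[OF lay, of k i] ne
    by (simp add: triangle_form_def algebra_simps)
  then have "triangle_form d i j k X + triangle_form d i j k Y > 0"
    using edge_weights_layout(2)[OF lay ne] by simp
  moreover have "s * (triangle_form d i j k X + triangle_form d i j k Y) \<ge> 0"
    unfolding distrib_left square using \<sigma> by simp
  ultimately have "s \<ge> 0"
    by (simp add: zero_le_mult_iff)
  moreover have "s \<noteq> 0"
  proof
    assume "s = 0"
    then have "?w1 = - ?w2" by (simp add: s_def)
    then have "\<sigma> = - ?w2\<^sup>2" unfolding \<sigma>_def by (simp add: power2_eq_square algebra_simps)
    then show False using \<sigma> zero_le_power2[of ?w2] by linarith
  qed
  ultimately have s: "s > 0" by simp
  have "s * triangle_form d i j k x \<ge> 0"
    unfolding square using \<sigma> by simp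
  then show "triangle_form d i j k x \<ge> 0"
    using s by (simp add: zero_le_mult_iff)
  assume "triangle_form d i j k x = 0"
  then have *: "(s * (x j - x i) - ?w2 * (x k - x i))\<^sup>2 + \<sigma> * (x k - x i)\<^sup>2 = 0"
    using square[of x] by simp
  have nn: "0 \<le> \<sigma> * (x k - x i)\<^sup>2" "0 \<le> (s * (x j - x i) - ?w2 * (x k - x i))\<^sup>2"
    using \<sigma> by simp_all
  then have "\<sigma> * (x k - x i)\<^sup>2 = 0" "(s * (x j - x i) - ?w2 * (x k - x i))\<^sup>2 = 0"
    using * by linarith+
  then show "x i = x j"
    using \<sigma> s by simp
qed

text \<open>
  Multiplied by the three lengths, \<open>ceva_sum\<close> equals \<open>4 A\<^sup>2 (r\<^sup>2 - \<bar>c - z\<bar>\<^sup>2)\<close>, where \<open>A\<close> is the area, \<open>c\<close>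
  the center and \<open>z\<close>, \<open>r\<close> are the center and radius of the circumcircle.
\<close>

lemma ceva_sum_pos_center_in_circumcircle:
  fixes p :: "'v \<Rightarrow> real ^ 2"
  assumes real: "realizes (len d) {i, j, k} p" and ne: "i \<noteq> j" "j \<noteq> k" "i \<noteq> k"
    and "center_in_circumcircle d {i, j, k} p"
  shows "ceva_sum d i j k > 0"
proof -
  obtain c z r where c: "triangle_center d {i, j, k} p c" and sphere: "p ` {i, j, k} \<subseteq> sphere z r"
    and ball: "c \<in> ball z r"
    using assms(5) unfolding center_in_circumcircle_def by blast
  have edge: "0 < len d a b \<and> d a b * len d a b = (c - p a) \<bullet> (p b - p a)"
    if "a \<in> {i, j, k}" "b \<in> {i, j, k}" "a \<noteq> b" for a b
  proof -
    have "p a \<noteq> p b"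
      using real that unfolding realizes_def inj_on_def by blast
    moreover have l: "len d a b = norm (p b - p a)"
      using real that unfolding realizes_def by (metis dist_commute dist_norm)
    ultimately have pos: "0 < norm (p b - p a)" by simp
    have "orthogonal (c - (p a + (d a b / norm (p b - p a)) *\<^sub>R (p b - p a))) (p b - p a)"
      using c that unfolding triangle_center_def by blast
    then have "(c - p a) \<bullet> (p b - p a) = d a b / norm (p b - p a) * ((p b - p a) \<bullet> (p b - p a))"
      unfolding orthogonal_def by (simp add: inner_diff_left inner_add_left algebra_simps)
    also have "\<dots> = d a b * len d a b"
      using pos unfolding l by (simp add: power2_norm_eq_inner[symmetric] power2_eq_square)
    finally show ?thesis using pos l by simp
  qed
  define P Q R S where "P = p j $ 1 - p i $ 1" and "Q = p j $ 2 - p i $ 2"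
    and "R = p k $ 1 - p i $ 1" and "S = p k $ 2 - p i $ 2"
  define e h where "e = c $ 1 - p i $ 1" and "h = c $ 2 - p i $ 2"
  define m n where "m = z $ 1 - p i $ 1" and "n = z $ 2 - p i $ 2"
  note defs = P_def Q_def R_def S_def e_def h_def m_def n_def
  have norms: "(p a $ 1 - z $ 1)\<^sup>2 + (p a $ 2 - z $ 2)\<^sup>2 = r\<^sup>2" if "a \<in> {i, j, k}" for a
  proof -
    have "norm (p a - z) = r"
      using sphere that by (auto simp: dist_norm norm_minus_commute)
    then show ?thesis
      using power2_norm_eq_inner[of "p a - z"] by (simp add: inner_2 power2_eq_square)
  qed
  have eq: "P\<^sup>2 + Q\<^sup>2 = 2 * (P * m + Q * n)" "R\<^sup>2 + S\<^sup>2 = 2 * (R * m + S * n)"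
    using norms[of i] norms[of j] norms[of k] unfolding defs
    by (simp_all add: power2_eq_square algebra_simps)
  have "norm (c - z) < r"
    using ball by (simp add: dist_norm norm_minus_commute)
  then have "(norm (c - z))\<^sup>2 < r\<^sup>2"
    by (intro power_strict_mono) auto
  then have "(c $ 1 - z $ 1)\<^sup>2 + (c $ 2 - z $ 2)\<^sup>2 < r\<^sup>2"
    using power2_norm_eq_inner[of "c - z"] by (simp add: inner_2 power2_eq_square)
  then have power: "2 * (e * m + h * n) - e\<^sup>2 - h\<^sup>2 > 0"
    using norms[of i] unfolding defs by (simp add: power2_eq_square algebra_simps)
  have "(P * S - Q * R)\<^sup>2 = (P\<^sup>2 + Q\<^sup>2) * (R\<^sup>2 + S\<^sup>2) - (P * R + Q * S)\<^sup>2"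
    by (simp add: power2_eq_square algebra_simps)
  also have "\<dots> = (len d i j)\<^sup>2 * (len d i k)\<^sup>2 - (((len d i j)\<^sup>2 + (len d i k)\<^sup>2 - (len d j k)\<^sup>2) / 2)\<^sup>2"
    unfolding realizes_triangle(7)[OF real ne, symmetric]
    unfolding realizes_triangle(1,2)[OF real ne] power2_norm_eq_inner
    by (simp add: inner_2 defs power2_eq_square)
  also have "\<dots> > 0"
    using realizes_triangle(8)[OF real ne] by (simp add: power_divide)
  finally have D: "(P * S - Q * R)\<^sup>2 > 0" .
  have dl: "d i j * len d i j = e * P + h * Q" "d i k * len d i k = e * R + h * S"
    "d j i * len d i j = (e - P) * (- P) + (h - Q) * (- Q)"
    "d k i * len d i k = (e - R) * (- R) + (h - S) * (- S)"
    "d j k * len d j k = (e - P) * (R - P) + (h - Q) * (S - Q)"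
    "d k j * len d j k = (e - R) * (P - R) + (h - S) * (Q - S)"
    using edge[of i j] edge[of i k] edge[of j i] edge[of k i] edge[of j k] edge[of k j] ne
    by (simp_all add: inner_2 defs len_commute[of d j i] len_commute[of d k i] len_commute[of d k j])
  have "ceva_sum d i j k * (len d i j * len d j k * len d i k) =
      (d i j * len d i j) * (d j k * len d j k) * (d k i * len d i k) +
      (d j i * len d i j) * (d k j * len d j k) * (d i k * len d i k)"
    by (simp add: ceva_sum_def algebra_simps)
  also have "\<dots> = (P * S - Q * R)\<^sup>2 * (2 * (e * m + h * n) - e\<^sup>2 - h\<^sup>2)"
    unfolding dl by (rule circumcircle_power_identity[OF eq])
  also have "\<dots> > 0"
    using D power by simp
  finally have "ceva_sum d i j k * (len d i j * len d j k * len d i k) > 0" .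
  moreover have "len d i j * len d j k * len d i k > 0"
    using edge[of i j] edge[of j k] edge[of i k] ne by simp
  ultimately show ?thesis
    by (rule zero_less_mult_pos2)
qed

section \<open>Topology of the triangulated surface\<close>

lemma convex_hull_axes_coordinates:
  fixes \<sigma> :: "'v::finite set"
  assumes "x \<in> convex hull ((\<lambda>v. axis v (1::real)) ` \<sigma>)"
  shows "\<And>v. v \<notin> \<sigma> \<Longrightarrow> x $ v = 0" and "(\<Sum>v\<in>UNIV. x $ v) = 1"
proof -
  let ?S = "{x :: real ^ 'v. (\<forall>v. v \<notin> \<sigma> \<longrightarrow> x $ v = 0) \<and> (\<Sum>v\<in>UNIV. x $ v) = 1}"
  have "convex hull ((\<lambda>v. axis v (1::real)) ` \<sigma>) \<subseteq> ?S"
  proof (rule hull_minimal)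
    show "(\<lambda>v. axis v (1::real)) ` \<sigma> \<subseteq> ?S"
      by (auto simp: axis_def)
    show "convex ?S"
      by (rule convexI) (auto simp: sum.distrib sum_distrib_left[symmetric])
  qed
  then show "\<And>v. v \<notin> \<sigma> \<Longrightarrow> x $ v = 0" "(\<Sum>v\<in>UNIV. x $ v) = 1"
    using assms by auto
qed

text \<open>
  On the geometric realization, the sum of the barycentric coordinates of the vertices in \<open>A\<close> is a
  continuous function. No simplex has vertices both in \<open>A\<close> and outside, so it takes only the values
  0 and 1, which is impossible for a nonconstant function on a connected space.
\<close>

lemma edge_connected:
  fixes T :: "'v::finite set set"
  assumes "triangulated_manifold n M T" "connected_space M"
    and closed: "\<And>i j. (i, j) \<in> directed_edges T \<Longrightarrow> i \<in> A \<Longrightarrow> j \<in> A"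
    and "a \<in> A"
  shows "A = UNIV"
proof (rule ccontr)
  assume "A \<noteq> UNIV"
  then obtain b where b: "b \<notin> A" by auto
  let ?G = "geometric_realization T" and ?\<phi> = "\<lambda>x :: real ^ 'v. \<Sum>v\<in>A. x $ v"
  have cpx: "abstract_complex T" and "top_of_set ?G homeomorphic_space M"
    using assms(1) by (auto simp: triangulated_manifold_def)
  then have "connected_space (top_of_set ?G)"
    using assms(2) homeomorphic_connected_space by blast
  then have "connected ?G"
    unfolding connectedin_iff_connected[symmetric] connectedin_def by simp
  then have conn: "connected (?\<phi> ` ?G)"
    by (intro connected_continuous_image continuous_intros)
  have axis: "axis v (1::real) \<in> ?G" for v :: 'v
  proof -
    have "{v} \<in> T" using cpx by (auto simp: abstract_complex_def)
    then show ?thesis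
      unfolding geometric_realization_def by (rule UN_I) simp
  qed
  have "?\<phi> (axis a 1) = 1" "?\<phi> (axis b 1) = 0"
    using \<open>a \<in> A\<close> b by (simp_all add: axis_def)
  then have "0 \<in> ?\<phi> ` ?G" "1 \<in> ?\<phi> ` ?G"
    using axis by (metis image_eqI)+
  then have "1/2 \<in> ?\<phi> ` ?G"
    using connectedD_interval[OF conn, of 0 1 "1/2"] by simp
  then obtain x where x: "x \<in> ?G" "?\<phi> x = 1/2" by auto
  then obtain \<sigma> where \<sigma>: "\<sigma> \<in> T" "x \<in> convex hull ((\<lambda>v. axis v 1) ` \<sigma>)"
    unfolding geometric_realization_def by auto
  have edge: "(i, j) \<in> directed_edges T" if "i \<in> \<sigma>" "j \<in> \<sigma>" "i \<noteq> j" for i j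
  proof -
    have "{i, j} \<subseteq> \<sigma>" "{i, j} \<noteq> {}" using that by auto
    then have "{i, j} \<in> T" using cpx \<sigma>(1) unfolding abstract_complex_def by blast
    then show ?thesis using that by (simp add: directed_edges_def)
  qed
  show False
  proof (cases "\<sigma> \<inter> A = {}")
    case True
    then have "?\<phi> x = 0"
      by (intro sum.neutral ballI convex_hull_axes_coordinates(1)[OF \<sigma>(2)]) auto
    then show False using x by simp
  next
    case False
    then have "\<sigma> \<subseteq> A" using edge closed by blast
    then have "?\<phi> x = (\<Sum>v\<in>UNIV. x $ v)"
      by (intro sum.mono_neutral_left ballI convex_hull_axes_coordinates(1)[OF \<sigma>(2)]) auto
    then show False using x convex_hull_axes_coordinates(2)[OF \<sigma>(2)] by simp
  qed
qed

text \<open>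
  The interior of an edge that lies in no triangle would be open in the geometric realization.
  It is parametrized injectively by the barycentric coordinate of \<open>i\<close>, so a chart
  would give a continuous injection of an open subset of the plane into the line, against invariance of
  dimension. Thus purity of the complex, without which an edge would not contribute to any angle, follows
  from the manifold property.
\<close>

lemma edge_in_triangle:
  fixes T :: "'v::finite set set"
  assumes "triangulated_manifold 2 M T" "(i, j) \<in> directed_edges T"
  obtains k where "is_triangle T i j k"
proof (rule ccontr)
  assume "\<not> thesis"
  then have none: "\<not> is_triangle T i j k" for k using that by blast
  let ?G = "geometric_realization T"
  have ij: "i \<noteq> j" "{i, j} \<in> T" using assms(2) by (auto simp: directed_edges_def)
  have cpx: "abstract_complex T" and man: "topological_manifold 2 M"
    using assms(1) by (auto simp: triangulated_manifold_def)
  obtain h g where hom: "homeomorphic_maps (top_of_set ?G) M h g"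
    using assms(1) by (auto simp: triangulated_manifold_def homeomorphic_space_def)
  then have h: "continuous_map (top_of_set ?G) M h" and g: "continuous_map M (top_of_set ?G) g"
    and gh: "\<And>x. x \<in> ?G \<Longrightarrow> g (h x) = x" and hg: "\<And>y. y \<in> topspace M \<Longrightarrow> h (g y) = y"
    by (auto simp: homeomorphic_maps_def)
  define S where "S = ?G \<inter> {x. x $ i > 0 \<and> x $ j > 0}"
  have S_open: "openin (top_of_set ?G) S"
    unfolding S_def
    by (intro openin_open_Int open_Collect_conj open_Collect_less continuous_intros)
  have inj_S: "x = y" if "x \<in> S" "y \<in> S" "x $ i = y $ i" for x y
  proof -
    have *: "x $ j = 1 - x $ i \<and> (\<forall>v. v \<noteq> i \<and> v \<noteq> j \<longrightarrow> x $ v = 0)" if xS: "x \<in> S" for x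
    proof -
      obtain \<sigma> where \<sigma>: "\<sigma> \<in> T" "x \<in> convex hull ((\<lambda>v. axis v 1) ` \<sigma>)"
        using xS unfolding S_def geometric_realization_def by auto
      note coord = convex_hull_axes_coordinates[OF \<sigma>(2)]
      have "i \<in> \<sigma>" "j \<in> \<sigma>"
        using coord(1)[of i] coord(1)[of j] xS by (auto simp: S_def)
      moreover have "k \<notin> \<sigma>" if "k \<noteq> i" "k \<noteq> j" for k
      proof
        assume "k \<in> \<sigma>"
        then have "{i, j, k} \<subseteq> \<sigma>" "{i, j, k} \<noteq> {}" using \<open>i \<in> \<sigma>\<close> \<open>j \<in> \<sigma>\<close> by auto
        then have "{i, j, k} \<in> T" using cpx \<sigma>(1) unfolding abstract_complex_def by blast
        then show False using none[of k] ij that by (auto simp: is_triangle_def)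
      qed
      ultimately have zero: "\<forall>v. v \<noteq> i \<and> v \<noteq> j \<longrightarrow> x $ v = 0"
        using coord(1) by blast
      then have "(\<Sum>v\<in>UNIV. x $ v) = (\<Sum>v\<in>{i, j}. x $ v)"
        by (intro sum.mono_neutral_right) auto
      then show ?thesis using coord(2) ij(1) zero by simp
    qed
    show ?thesis
      unfolding vec_eq_iff using *[OF that(1)] *[OF that(2)] that(3) by metis
  qed
  \<comment> \<open>The midpoint of the edge, as a point at which to take a chart.\<close>
  define x0 :: "real ^ 'v" where "x0 = (1/2) *\<^sub>R axis i 1 + (1/2) *\<^sub>R axis j 1"
  have "x0 \<in> convex hull ((\<lambda>v. axis v 1) ` {i, j})"
    unfolding x0_def by (intro convexD[OF convex_convex_hull]) (auto intro: hull_inc)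
  then have x0G: "x0 \<in> ?G"
    unfolding geometric_realization_def using ij(2) by blast
  then have x0: "x0 \<in> S"
    using ij(1) by (simp add: S_def x0_def axis_def)
  have hx0: "h x0 \<in> topspace M"
    using h x0G by (auto simp: continuous_map_def)
  then obtain U W where U: "openin M U" "h x0 \<in> U" and W: "openin (Euclidean_space 2) W"
    and "subtopology M U homeomorphic_space subtopology (Euclidean_space 2) W"
    using man unfolding topological_manifold_def by blast
  then obtain \<phi> \<psi> where chart:
    "homeomorphic_maps (subtopology M U) (subtopology (Euclidean_space 2) W) \<phi> \<psi>"
    by (auto simp: homeomorphic_space_def)
  have UM: "topspace (subtopology M U) = U" and WE: "topspace (subtopology (Euclidean_space 2) W) = W"
    using openin_subset[OF U(1)] openin_subset[OF W] by auto
  have \<phi>: "continuous_map (subtopology M U) (subtopology (Euclidean_space 2) W) \<phi>"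
    and \<psi>: "continuous_map (subtopology (Euclidean_space 2) W) (subtopology M U) \<psi>"
    and \<psi>\<phi>: "\<And>x. x \<in> U \<Longrightarrow> \<psi> (\<phi> x) = x" and \<phi>\<psi>: "\<And>y. y \<in> W \<Longrightarrow> \<phi> (\<psi> y) = y"
    using chart UM WE by (auto simp: homeomorphic_maps_def)
  have g\<psi>: "continuous_map (subtopology (Euclidean_space 2) W) (top_of_set ?G) (g \<circ> \<psi>)"
    using continuous_map_compose[OF \<psi> continuous_map_from_subtopology[OF g]] .
  define O1 where "O1 = {z \<in> W. (g \<circ> \<psi>) z \<in> S}"
  have "openin (subtopology (Euclidean_space 2) W) O1"
    using openin_continuous_map_preimage[OF g\<psi> S_open] by (simp only: WE O1_def)
  then have O1: "openin (Euclidean_space 2) O1"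
    using W openin_trans_full by blast
  \<comment> \<open>The chart is pulled back to the plane of pairs, where invariance of dimension applies.\<close>
  define e :: "real \<times> real \<Rightarrow> nat \<Rightarrow> real"
    where "e = (\<lambda>z n. if n < 2 then if n = 0 then fst z else snd z else 0)"
  have e: "continuous_map euclidean (Euclidean_space 2) e"
    unfolding e_def continuous_map_componentwise_Euclidean_space
    by (auto intro!: continuous_intros)
  have inj_e: "z = z'" if "e z = e z'" for z z'
    using fun_cong[OF that, of 0] fun_cong[OF that, of 1] by (simp add: e_def prod_eq_iff)
  define O2 where "O2 = {z. e z \<in> O1}"
  have "open O2"
    using openin_continuous_map_preimage[OF e O1] by (simp add: O2_def)
  moreover have "O2 \<noteq> {}"
  proof -
    have "\<phi> (h x0) \<in> W"
      using \<phi> U(2) UM WE by (auto simp: continuous_map_def)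
    then have "\<phi> (h x0) \<in> O1"
      using \<psi>\<phi>[OF U(2)] gh[OF x0G] x0 by (simp add: O1_def)
    moreover have "e (\<phi> (h x0) 0, \<phi> (h x0) 1) = \<phi> (h x0)"
    proof -
      have "\<forall>n\<ge>2. \<phi> (h x0) n = 0"
        using \<open>\<phi> (h x0) \<in> W\<close> openin_subset[OF W] by (auto simp: topspace_Euclidean_space)
      then show ?thesis by (auto simp: e_def fun_eq_iff less_2_cases_iff)
    qed
    ultimately show ?thesis unfolding O2_def by (metis (mono_tags) empty_iff mem_Collect_eq)
  qed
  moreover have "continuous_on O2 (\<lambda>z. (g (\<psi> (e z))) $ i)"
  proof -
    have "continuous_map (top_of_set O2) (subtopology (Euclidean_space 2) W) e"
      using e by (auto simp: continuous_map_in_subtopology O2_def O1_def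
          intro: continuous_map_from_subtopology)
    from continuous_map_compose[OF this g\<psi>] have "continuous_on O2 (g \<circ> \<psi> \<circ> e)"
      by simp
    then show ?thesis by (auto intro!: continuous_intros simp: o_def)
  qed
  moreover have "inj_on (\<lambda>z. (g (\<psi> (e z))) $ i) O2"
  proof (rule inj_onI)
    fix z z' assume z: "z \<in> O2" "z' \<in> O2" "(g (\<psi> (e z))) $ i = (g (\<psi> (e z'))) $ i"
    then have "g (\<psi> (e z)) = g (\<psi> (e z'))"
      by (intro inj_S) (auto simp: O2_def O1_def)
    moreover have "e z \<in> W" "e z' \<in> W"
      using z by (auto simp: O2_def O1_def)
    moreover have "\<psi> y \<in> topspace M" if "y \<in> W" for y
      using \<psi> that UM WE openin_subset[OF U(1)] unfolding continuous_map_def by blast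
    ultimately have "e z = e z'"
      using hg \<phi>\<psi> by metis
    then show "z = z'" by (rule inj_e)
  qed
  ultimately have "DIM(real \<times> real) \<le> DIM(real)"
    by (intro invariance_of_dimension)
  then show False by simp
qed

section \<open>First variation of lengths under a conformal structure\<close>

lemma smooth_on_imp_differentiable:
  "smooth_on S f \<Longrightarrow> x \<in> S \<Longrightarrow> f differentiable (at x)"
  unfolding smooth_on_def by (metis Ck_on.simps(2))

lemma directed_edges_commute: "(i, j) \<in> directed_edges T \<longleftrightarrow> (j, i) \<in> directed_edges T"
  by (auto simp: directed_edges_def insert_commute)

lemma triangle_edges:
  assumes "abstract_complex T" "is_triangle T i j k" "a \<in> {i, j, k}" "b \<in> {i, j, k}" "a \<noteq> b"
  shows "(a, b) \<in> directed_edges T"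
proof -
  have "{i, j, k} \<in> T" using assms(2) by (simp add: is_triangle_def)
  moreover have "{a, b} \<subseteq> {i, j, k}" "{a, b} \<noteq> {}" using assms(3,4) by auto
  ultimately have "{a, b} \<in> T"
    using assms(1) unfolding abstract_complex_def by blast
  then show ?thesis using assms(5) by (simp add: directed_edges_def)
qed

lemma conformal_structure_differentiable:
  assumes "conformal_structure T U C" "(i, j) \<in> directed_edges T" "g \<in> U"
  shows "(\<lambda>g. C g i j) differentiable (at g)"
  using assms smooth_on_imp_differentiable unfolding conformal_structure_def by fast

text \<open>
  Along a curve a length varies through both of its ends. The two partial derivatives are
  given by the first axiom of a conformal structure, used for both directions of the edge; by the second
  axiom the length does not depend on the other vertices.
\<close>

lemma conformal_len_has_derivative:
  fixes f :: "real \<Rightarrow> real ^ 'v::finite"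
  assumes C: "conformal_structure T U C" and edge: "(i, j) \<in> directed_edges T"
    and f: "(f has_vector_derivative x) (at t)" and U: "f t \<in> U"
  shows "((\<lambda>s. len (C (f s)) i j) has_real_derivative
    C (f t) i j * x $ i + C (f t) j i * x $ j) (at t)"
proof -
  let ?F = "\<lambda>g. len (C g) i j"
  have ne: "i \<noteq> j" and edge': "(j, i) \<in> directed_edges T"
    using edge directed_edges_commute by (auto simp: directed_edges_def insert_commute)
  have "?F differentiable (at (f t))"
    unfolding len_def using conformal_structure_differentiable[OF C _ U] edge edge'
    by (intro differentiable_add) auto
  then obtain F' where F': "(?F has_derivative F') (at (f t))"
    unfolding differentiable_def by blast
  then have lin: "linear F'" by (rule has_derivative_linear)
  have along: "((\<lambda>s. ?F (c s)) has_real_derivative F' v) (at r)"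
    if "(c has_vector_derivative v) (at r)" "c r = f t" for c v and r :: real
  proof -
    have "((\<lambda>s. ?F (c s)) has_derivative (\<lambda>h. F' (h *\<^sub>R v))) (at r)"
      using has_derivative_compose[OF that(1)[unfolded has_vector_derivative_def]] F' that(2) by simp
    then show ?thesis
      by (simp add: has_field_derivative_def linear_cmul[OF lin] mult.commute[of _ "F' v"])
  qed
  have partial: "F' (axis k 1) = D" if "has_partial ?F k (f t) D" for k D
  proof -
    have "((\<lambda>s. f t + s *\<^sub>R axis k 1) has_vector_derivative axis k 1) (at 0)"
      by (auto intro!: derivative_eq_intros)
    then have "((\<lambda>s. ?F (f t + s *\<^sub>R axis k 1)) has_real_derivative F' (axis k 1)) (at 0)"
      by (rule along) simp
    then show ?thesis
      using that DERIV_unique unfolding has_partial_def by blast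
  qed
  have parts: "has_partial (\<lambda>g. len (C g) a b) a (f t) (C (f t) a b)"
    "\<And>k. k \<noteq> a \<Longrightarrow> k \<noteq> b \<Longrightarrow> has_partial (\<lambda>g. C g a b) k (f t) 0"
    if "(a, b) \<in> directed_edges T" for a b
    using C U that unfolding conformal_structure_def by fast+
  have Fi: "F' (axis i 1) = C (f t) i j"
    using parts(1)[OF edge] by (rule partial)
  have Fj: "F' (axis j 1) = C (f t) j i"
    using parts(1)[OF edge'] by (intro partial) (simp add: len_commute)
  have Fk: "F' (axis k 1) = 0" if "k \<noteq> i" "k \<noteq> j" for k
    using parts(2)[OF edge that] parts(2)[OF edge' that(2,1)]
    unfolding has_partial_def by (intro partial) (auto simp: has_partial_def len_def dest: DERIV_add)
  have "F' x = (\<Sum>k\<in>UNIV. x $ k * F' (axis k 1))"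
  proof -
    have "x = (\<Sum>k\<in>UNIV. x $ k *\<^sub>R axis k 1)"
      using basis_expansion[of x] by (simp add: scalar_mult_eq_scaleR)
    then have "F' x = F' (\<Sum>k\<in>UNIV. x $ k *\<^sub>R axis k 1)" by simp
    then show ?thesis
      by (simp add: linear_sum[OF lin] linear_cmul[OF lin])
  qed
  also have "\<dots> = (\<Sum>k\<in>{i, j}. x $ k * F' (axis k 1))"
    using Fk by (intro sum.mono_neutral_right) auto
  also have "\<dots> = C (f t) i j * x $ i + C (f t) j i * x $ j"
    using ne by (simp add: Fi Fj)
  finally show ?thesis
    using along[OF f] by simp
qed


section \<open>The Dirichlet energy of the surface\<close>

text \<open>
  Ordered triples: every triangle is counted six times, which makes all sums below symmetric.
\<close>

definition triangles :: "'v::finite set set \<Rightarrow> ('v \<times> 'v \<times> 'v) set" where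
  "triangles T = {(i, j, k). is_triangle T i j k}"

lemma is_triangle_commute:
  "is_triangle T i j k \<longleftrightarrow> is_triangle T j i k" "is_triangle T i j k \<longleftrightarrow> is_triangle T i k j"
  by (auto simp: is_triangle_def insert_commute)

lemma sum_triangles_swap:
  "(\<Sum>(i, j, k)\<in>triangles T. \<phi> j i k) = (\<Sum>(i, j, k)\<in>triangles T. \<phi> i j k)"
  "(\<Sum>(i, j, k)\<in>triangles T. \<phi> i k j) = (\<Sum>(i, j, k)\<in>triangles T. \<phi> i j k)"
  by (rule sum.reindex_bij_witness[where i = "\<lambda>(i, j, k). (j, i, k)" and j = "\<lambda>(i, j, k). (j, i, k)"];
      auto simp: triangles_def is_triangle_commute(1))
    (rule sum.reindex_bij_witness[where i = "\<lambda>(i, j, k). (i, k, j)" and j = "\<lambda>(i, j, k). (i, k, j)"];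
      auto simp: triangles_def is_triangle_commute(2))

definition dirichlet_energy :: "'v::finite set set \<Rightarrow> ('v \<Rightarrow> 'v \<Rightarrow> real) \<Rightarrow> ('v \<Rightarrow> real) \<Rightarrow> real" where
  "dirichlet_energy T d x = (\<Sum>(i, j, k)\<in>triangles T. edge_weight d i j k * (x j - x i)\<^sup>2)"

text \<open>
  Summation by parts: by symmetry both terms in the inner sum contribute the same, and exchanging \<open>i\<close>
  and \<open>j\<close> antisymmetrizes the factor \<open>x i\<close> into \<open>(x i - x j) / 2\<close>.
\<close>

lemma dirichlet_energy_by_parts:
  assumes pf: "pf_metric T d"
  shows "dirichlet_energy T d x =
    - (\<Sum>i\<in>UNIV. x i * (\<Sum>(j, k) | is_triangle T i j k.
        edge_weight d i j k * (x j - x i) + edge_weight d i k j * (x k - x i)))"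
proof -
  define A where "A = (\<lambda>i j k. edge_weight d i j k * (x j - x i))"
  have sym: "edge_weight d i j k = edge_weight d j i k" if tri: "is_triangle T i j k" for i j k
  proof -
    obtain X Y u w where "centered_layout d {i, j, k} X Y u w"
      using pf_metric_centered_layout[OF pf tri] by blast
    then show ?thesis
      using tri by (intro edge_weight_commute) (auto simp: is_triangle_def)
  qed
  have "(\<Sum>i\<in>UNIV. x i * (\<Sum>(j, k) | is_triangle T i j k. A i j k + A i k j)) =
      (\<Sum>i\<in>UNIV. \<Sum>jk\<in>{(j, k). is_triangle T i j k}. case jk of (j, k) \<Rightarrow> x i * (A i j k + A i k j))"
    by (simp add: sum_distrib_left split_def)
  also have "\<dots> = (\<Sum>(i, j, k)\<in>(SIGMA i:UNIV. {(j, k). is_triangle T i j k}). x i * (A i j k + A i k j))"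
    by (subst sum.Sigma) auto
  also have "(SIGMA i:UNIV. {(j, k). is_triangle T i j k}) = triangles T"
    by (auto simp: triangles_def)
  also have "(\<Sum>(i, j, k)\<in>triangles T. x i * (A i j k + A i k j)) =
      (\<Sum>(i, j, k)\<in>triangles T. x i * A i j k) + (\<Sum>(i, j, k)\<in>triangles T. x i * A i k j)"
    by (simp add: sum.distrib[symmetric] split_def distrib_left)
  also have "(\<Sum>(i, j, k)\<in>triangles T. x i * A i k j) = (\<Sum>(i, j, k)\<in>triangles T. x i * A i j k)"
    by (rule sum_triangles_swap(2))
  also have "(\<Sum>(i, j, k)\<in>triangles T. x i * A i j k) + (\<Sum>(i, j, k)\<in>triangles T. x i * A i j k) =
      (\<Sum>(i, j, k)\<in>triangles T. x i * A i j k) + (\<Sum>(i, j, k)\<in>triangles T. x j * A j i k)"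
    using sum_triangles_swap(1)[of "\<lambda>i j k. x i * A i j k" T] by simp
  also have "\<dots> = (\<Sum>(i, j, k)\<in>triangles T. - (edge_weight d i j k * (x j - x i)\<^sup>2))"
    unfolding sum.distrib[symmetric]
    by (rule sum.cong[OF refl])
      (auto simp: triangles_def A_def sym[symmetric] power2_eq_square algebra_simps)
  finally show ?thesis
    unfolding dirichlet_energy_def A_def by (simp add: sum_negf split_def)
qed

lemma dirichlet_energy_triangle_forms:
  "3 * dirichlet_energy T d x = (\<Sum>(i, j, k)\<in>triangles T. triangle_form d i j k x)"
proof -
  let ?q = "\<lambda>i j k. edge_weight d i j k * (x j - x i)\<^sup>2"
  have rot: "(\<Sum>(i, j, k)\<in>triangles T. \<phi> j k i) = (\<Sum>(i, j, k)\<in>triangles T. \<phi> i j k)" for \<phi> :: "'a \<Rightarrow> 'a \<Rightarrow> 'a \<Rightarrow> real"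
    using sum_triangles_swap(1)[of "\<lambda>i j k. \<phi> i k j" T] sum_triangles_swap(2)[of \<phi> T] by simp
  have "(\<Sum>(i, j, k)\<in>triangles T. triangle_form d i j k x) =
      (\<Sum>(i, j, k)\<in>triangles T. ?q i j k) + (\<Sum>(i, j, k)\<in>triangles T. ?q j k i)
      + (\<Sum>(i, j, k)\<in>triangles T. ?q k i j)"
    by (simp add: sum.distrib[symmetric] split_def triangle_form_def)
  then show ?thesis
    using rot[of ?q] rot[of "\<lambda>i j k. ?q j k i"] unfolding dirichlet_energy_def by simp
qed

lemma dirichlet_energy_dual_lengths:
  assumes "abstract_complex T"
  shows "dirichlet_energy T d x =
    (\<Sum>(i, j)\<in>directed_edges T. dual_length T d i j / len d i j * (x j - x i)\<^sup>2)"
proof -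
  have edge: "(a, b) \<in> directed_edges T" if "is_triangle T a b c" for a b c
    using triangle_edges[OF assms that, of a b] that by (auto simp: is_triangle_def)
  have "(\<Sum>(i, j)\<in>directed_edges T. dual_length T d i j / len d i j * (x j - x i)\<^sup>2) =
      (\<Sum>e\<in>directed_edges T. \<Sum>k\<in>{k. is_triangle T (fst e) (snd e) k}.
        edge_weight d (fst e) (snd e) k * (x (snd e) - x (fst e))\<^sup>2)"
    by (simp add: split_def dual_length_def edge_weight_def sum_distrib_right sum_divide_distrib)
  also have "\<dots> = (\<Sum>(e, k)\<in>(SIGMA e:directed_edges T. {k. is_triangle T (fst e) (snd e) k}).
        edge_weight d (fst e) (snd e) k * (x (snd e) - x (fst e))\<^sup>2)"
    by (subst sum.Sigma) auto
  also have "\<dots> = dirichlet_energy T d x"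
    unfolding dirichlet_energy_def
    by (rule sum.reindex_bij_witness[where i = "\<lambda>(i, j, k). ((i, j), k)" and j = "\<lambda>(e, k). (fst e, snd e, k)"])
      (use edge in \<open>auto simp: triangles_def\<close>)
  finally show ?thesis ..
qed

text \<open>
  The energy is a sum of nonnegative terms, grouped by edges in the first case and by triangles in the
  second. Each term vanishes, and each edge occurs in some term because it lies in a triangle.
\<close>

lemma dirichlet_energy_zero:
  assumes cpx: "abstract_complex T" and pf: "pf_metric T d"
    and pure: "\<And>i j. (i, j) \<in> directed_edges T \<Longrightarrow> \<exists>k. is_triangle T i j k"
    and positive: "(\<forall>(i, j)\<in>directed_edges T. dual_length T d i j > 0) \<or>
      (\<forall>(i, j, k)\<in>triangles T. ceva_sum d i j k > 0)"
    and zero: "dirichlet_energy T d x = 0"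
    and edge: "(i, j) \<in> directed_edges T"
  shows "x i = x j"
  using positive
proof
  assume dual: "\<forall>(i, j)\<in>directed_edges T. dual_length T d i j > 0"
  have pos: "dual_length T d a b / len d a b > 0" if ab: "(a, b) \<in> directed_edges T" for a b
  proof -
    obtain k where k: "is_triangle T a b k" using pure[OF ab] by blast
    obtain X Y u w where lay: "centered_layout d {a, b, k} X Y u w"
      using pf_metric_centered_layout[OF pf k] by blast
    have "len d a b > 0"
      using centered_layoutD(1)[OF lay, of a b] k by (auto simp: is_triangle_def)
    then show ?thesis using dual ab by auto
  qed
  have "(\<Sum>(i, j)\<in>directed_edges T. dual_length T d i j / len d i j * (x j - x i)\<^sup>2) = 0"
    using zero dirichlet_energy_dual_lengths[OF cpx] by metis
  then have "\<forall>(i, j)\<in>directed_edges T. dual_length T d i j / len d i j * (x j - x i)\<^sup>2 = 0"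
    by (subst (asm) sum_nonneg_eq_0_iff[OF finite])
      (auto simp del: times_divide_eq_left intro!: mult_nonneg_nonneg[OF less_imp_le[OF pos]])
  then have "dual_length T d i j / len d i j * (x j - x i)\<^sup>2 = 0"
    using edge by auto
  then show ?thesis using pos[OF edge] by (metis eq_iff_diff_eq_0 less_irrefl mult_eq_0_iff zero_eq_power2)
next
  assume ceva: "\<forall>(i, j, k)\<in>triangles T. ceva_sum d i j k > 0"
  have form: "triangle_form d a b e x \<ge> 0" "triangle_form d a b e x = 0 \<Longrightarrow> x a = x b"
    if tri: "is_triangle T a b e" for a b e
  proof -
    obtain X Y u w where lay: "centered_layout d {a, b, e} X Y u w"
      using pf_metric_centered_layout[OF pf tri] by blast
    have ne: "a \<noteq> b" "b \<noteq> e" "a \<noteq> e" and "ceva_sum d a b e > 0"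
      using tri ceva by (auto simp: is_triangle_def triangles_def)
    then show "triangle_form d a b e x \<ge> 0" "triangle_form d a b e x = 0 \<Longrightarrow> x a = x b"
      using triangle_form_pos_def[OF lay] by blast+
  qed
  obtain k where k: "is_triangle T i j k" using pure[OF edge] by blast
  have "(\<Sum>(i, j, k)\<in>triangles T. triangle_form d i j k x) = 0"
    using zero dirichlet_energy_triangle_forms[of T d x] by simp
  then have "\<forall>(i, j, k)\<in>triangles T. triangle_form d i j k x = 0"
    by (subst (asm) sum_nonneg_eq_0_iff) (use form(1) in \<open>auto simp: triangles_def\<close>)
  then have "triangle_form d i j k x = 0"
    using k by (auto simp: triangles_def)
  then show ?thesis using form(2)[OF k] by blast
qed

text \<open>
  By \<open>dirichlet_energy_by_parts\<close>, the energy is the pairing of \<open>x\<close> with the derivative of the curvature,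
  which is zero along a flat variation.
\<close>

lemma flat_variation_dirichlet_energy:
  fixes f :: "real \<Rightarrow> real ^ 'v::finite"
  assumes C: "conformal_structure T U C" and cpx: "abstract_complex T"
    and I: "open I" "t \<in> I" "f ` I \<subseteq> U"
    and f: "(f has_vector_derivative x) (at t)"
    and flat: "\<And>s i. s \<in> I \<Longrightarrow> curvature T (len (C (f s))) i = 0"
  shows "dirichlet_energy T (C (f t)) (\<lambda>i. x $ i) = 0"
proof -
  have pf: "pf_metric T (C (f s))" if "s \<in> I" for s
    using C I(3) that unfolding conformal_structure_def by blast
  have U: "f t \<in> U" using I by blast
  let ?d = "C (f t)"
  have angle: "((\<lambda>s. tri_angle (len (C (f s))) i j k) has_real_derivative
      edge_weight ?d i j k * (x $ j - x $ i) + edge_weight ?d i k j * (x $ k - x $ i)) (at t)"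
    if tri: "is_triangle T i j k" for i j k
  proof -
    obtain X Y u w where lay: "centered_layout ?d {i, j, k} X Y u w"
      using pf_metric_centered_layout[OF pf[OF I(2)] tri] by blast
    have ne: "i \<noteq> j" "j \<noteq> k" "i \<noteq> k" using tri by (auto simp: is_triangle_def)
    show ?thesis
      using lay ne I(1,2) pf_metric_centered_layout[OF pf tri]
        conformal_len_has_derivative[OF C triangle_edges[OF cpx tri] f U]
      by (rule tri_angle_has_derivative[where d = "\<lambda>s. C (f s)"])
  qed
  have "(\<Sum>(j, k) | is_triangle T i j k.
      edge_weight ?d i j k * (x $ j - x $ i) + edge_weight ?d i k j * (x $ k - x $ i)) = 0" for i
  proof -
    let ?D = "\<Sum>(j, k) | is_triangle T i j k.
      edge_weight ?d i j k * (x $ j - x $ i) + edge_weight ?d i k j * (x $ k - x $ i)"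
    have "((\<lambda>s. \<Sum>(j, k) | is_triangle T i j k. tri_angle (len (C (f s))) i j k)
        has_real_derivative ?D) (at t)"
      unfolding split_def by (intro DERIV_sum angle) auto
    then have "((\<lambda>s. curvature T (len (C (f s))) i) has_real_derivative 0 - ?D / 2) (at t)"
      unfolding curvature_def by (intro DERIV_diff DERIV_const DERIV_cdivide)
    moreover have "((\<lambda>s. curvature T (len (C (f s))) i) has_real_derivative 0) (at t)"
      by (rule has_field_derivative_transform_within_open[OF DERIV_const I(1,2)]) (simp add: flat)
    ultimately show ?thesis
      using DERIV_unique by fastforce
  qed
  then show ?thesis
    unfolding dirichlet_energy_by_parts[OF pf[OF I(2)]] by simp
qed


section \<open>Metrics with positive definite Dirichlet energy\<close>

lemma height_cong:
  assumes "centered_layout d {i, j, k} X Y u w" "centered_layout d' {i, j, k} X' Y' u' w'"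
    and ne: "i \<noteq> j" "j \<noteq> k" "i \<noteq> k"
    and eq: "\<And>a b. a \<in> {i, j, k} \<Longrightarrow> b \<in> {i, j, k} \<Longrightarrow> a \<noteq> b \<Longrightarrow> d a b = d' a b"
  shows "height d i j k = height d' i j k"
proof -
  have "len d a b = len d' a b" if "a \<in> {i, j, k}" "b \<in> {i, j, k}" "a \<noteq> b" for a b
    using eq[of a b] eq[of b a] that by (auto simp: len_def)
  then have "tri_angle (len d) i j k = tri_angle (len d') i j k"
    unfolding tri_angle_eq_arccos[OF assms(1) ne] tri_angle_eq_arccos[OF assms(2) ne]
    using ne by simp
  then show ?thesis
    unfolding height_def using eq[of i j] eq[of i k] ne by simp
qed

lemma isCont_height:
  fixes d :: "real \<Rightarrow> 'v \<Rightarrow> 'v \<Rightarrow> real"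
  assumes ne: "i \<noteq> j" "j \<noteq> k" "i \<noteq> k"
    and nbhd: "open S" "t \<in> S" "\<And>s. s \<in> S \<Longrightarrow> \<exists>X Y u w. centered_layout (d s) {i, j, k} X Y u w"
    and cont: "\<And>a b. a \<in> {i, j, k} \<Longrightarrow> b \<in> {i, j, k} \<Longrightarrow> a \<noteq> b \<Longrightarrow> isCont (\<lambda>s. d s a b) t"
  shows "isCont (\<lambda>s. height (d s) i j k) t"
proof -
  let ?C = "\<lambda>s. law_of_cosines (len (d s) i j) (len (d s) i k) (len (d s) j k)"
  obtain X Y u w where lay: "centered_layout (d t) {i, j, k} X Y u w"
    using nbhd(2,3) by blast
  have C: "-1 < ?C t" "?C t < 1"
    using law_of_cosines_layout[OF lay ne] by auto
  have pos: "len (d t) i j > 0" "len (d t) i k > 0"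
    using centered_layoutD(1)[OF lay, of i j] centered_layoutD(1)[OF lay, of i k] ne by auto
  have len: "isCont (\<lambda>s. len (d s) a b) t"
    if "a \<in> {i, j, k}" "b \<in> {i, j, k}" "a \<noteq> b" for a b
    unfolding len_def using cont[of a b] cont[of b a] that by (intro continuous_add) auto
  have "isCont ?C t"
    unfolding law_of_cosines_def using len[of i j] len[of i k] len[of j k] ne pos
    by (intro continuous_intros) auto
  then have "isCont (\<lambda>s. arccos (?C s)) t"
    using C by (intro isCont_o2[OF _ isCont_arccos]) auto
  moreover have "sin (arccos (?C t)) \<noteq> 0"
    using C by (simp add: sin_arccos_nonzero)
  ultimately have "isCont (\<lambda>s. (d s i k - d s i j * cos (arccos (?C s))) / sin (arccos (?C s))) t"
    using cont[of i j] cont[of i k] ne by (intro continuous_intros) auto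
  moreover have "\<forall>\<^sub>F s in nhds t. (d s i k - d s i j * cos (arccos (?C s))) / sin (arccos (?C s)) =
      height (d s) i j k"
    using eventually_nhds_in_open[OF nbhd(1,2)]
  proof eventually_elim
    case (elim s)
    then obtain X Y u w where "centered_layout (d s) {i, j, k} X Y u w" using nbhd(3) by blast
    then show ?case unfolding height_def by (simp add: tri_angle_eq_arccos[OF _ ne])
  qed
  ultimately show ?thesis
    using isCont_cong by force
qed

text \<open>
  A common consequence of the five hypotheses on the metric: the first alternative is the first of them,
  and the second one follows from each of the others. Unlike the hypotheses that refer to a special
  conformal structure, it is an open condition on \<open>d\<close>.
\<close>

definition stable_metric :: "'v::finite set set \<Rightarrow> ('v \<Rightarrow> 'v \<Rightarrow> real) \<Rightarrow> bool" where
  "stable_metric T d \<longleftrightarrow> (\<forall>(i, j)\<in>directed_edges T. dual_length T d i j > 0) \<or>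
      (\<forall>(i, j, k)\<in>triangles T. ceva_sum d i j k > 0)"

lemma eventually_stable_metric:
  fixes d :: "real \<Rightarrow> 'v::finite \<Rightarrow> 'v \<Rightarrow> real"
  assumes cpx: "abstract_complex T" and I: "open I" "t \<in> I"
    and pf: "\<And>s. s \<in> I \<Longrightarrow> pf_metric T (d s)"
    and cont: "\<And>i j. (i, j) \<in> directed_edges T \<Longrightarrow> isCont (\<lambda>s. d s i j) t"
    and stable: "stable_metric T (d t)"
  shows "\<forall>\<^sub>F s in nhds t. stable_metric T (d s)"
proof -
  have eventually_pos: "\<forall>\<^sub>F s in nhds t. F s > 0" if "isCont F t" "F t > 0" for F :: "real \<Rightarrow> real"
    using that order_tendstoD(1)[of F "F t" "nhds t" 0] by (simp add: continuous_at tendsto_at_iff_tendsto_nhds)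
  have cont': "isCont (\<lambda>s. d s a b) t"
    if "is_triangle T i j k" "a \<in> {i, j, k}" "b \<in> {i, j, k}" "a \<noteq> b" for i j k a b
    by (rule cont[OF triangle_edges[OF cpx that]])
  from stable show ?thesis
    unfolding stable_metric_def
  proof
    assume dual: "\<forall>(i, j)\<in>directed_edges T. dual_length T (d t) i j > 0"
    have "\<forall>\<^sub>F s in nhds t. \<forall>e\<in>directed_edges T. dual_length T (d s) (fst e) (snd e) > 0"
    proof (rule eventually_ball_finite[OF finite], rule ballI)
      fix e assume e: "e \<in> directed_edges T"
      have "isCont (\<lambda>s. dual_length T (d s) (fst e) (snd e)) t"
        unfolding dual_length_def
      proof (rule continuous_sum)
        fix k assume "k \<in> {k. is_triangle T (fst e) (snd e) k}"
        then have tri: "is_triangle T (fst e) (snd e) k" by simp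
        show "isCont (\<lambda>s. height (d s) (fst e) (snd e) k) t"
          using tri pf_metric_centered_layout[OF pf tri] cont'[OF tri]
          by (intro isCont_height[OF _ _ _ I]) (auto simp: is_triangle_def)
      qed
      moreover have "dual_length T (d t) (fst e) (snd e) > 0"
        using dual e by (simp add: split_def)
      ultimately show "\<forall>\<^sub>F s in nhds t. dual_length T (d s) (fst e) (snd e) > 0"
        by (rule eventually_pos)
    qed
    then show "\<forall>\<^sub>F s in nhds t. (\<forall>(i, j)\<in>directed_edges T. dual_length T (d s) i j > 0) \<or>
      (\<forall>(i, j, k)\<in>triangles T. ceva_sum (d s) i j k > 0)"
      by eventually_elim (simp add: split_def)
  next
    assume ceva: "\<forall>(i, j, k)\<in>triangles T. ceva_sum (d t) i j k > 0"
    have "\<forall>\<^sub>F s in nhds t. \<forall>e\<in>triangles T. case e of (i, j, k) \<Rightarrow> ceva_sum (d s) i j k > 0"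
    proof (rule eventually_ball_finite[OF finite], rule ballI)
      fix e assume e: "e \<in> triangles T"
      obtain i j k where ijk: "e = (i, j, k)" by (cases e)
      then have tri: "is_triangle T i j k" using e by (simp add: triangles_def)
      have "isCont (\<lambda>s. ceva_sum (d s) i j k) t"
        unfolding ceva_sum_def using tri
        by (intro continuous_intros cont'[OF tri]) (auto simp: is_triangle_def)
      moreover have "ceva_sum (d t) i j k > 0"
        using ceva e ijk by auto
      ultimately show "\<forall>\<^sub>F s in nhds t. case e of (i, j, k) \<Rightarrow> ceva_sum (d s) i j k > 0"
        using eventually_pos by (simp add: ijk)
    qed
    then show "\<forall>\<^sub>F s in nhds t. (\<forall>(i, j)\<in>directed_edges T. dual_length T (d s) i j > 0) \<or>
      (\<forall>(i, j, k)\<in>triangles T. ceva_sum (d s) i j k > 0)"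
      by eventually_elim blast
  qed
qed

text \<open>
  A metric is a function on all pairs of vertices, of which only the values on edges are meaningful; the
  start of a conformal variation agrees with the given metric on edges only.
\<close>

lemma stable_metric_cong:
  assumes cpx: "abstract_complex T" and pf: "pf_metric T d" "pf_metric T d'"
    and eq: "\<And>i j. (i, j) \<in> directed_edges T \<Longrightarrow> d' i j = d i j"
  shows "stable_metric T d' \<longleftrightarrow> stable_metric T d"
proof -
  have eq': "d' a b = d a b"
    if "is_triangle T i j k" "a \<in> {i, j, k}" "b \<in> {i, j, k}" "a \<noteq> b" for i j k a b
    by (rule eq[OF triangle_edges[OF cpx that]])
  have "height d' i j k = height d i j k" if tri: "is_triangle T i j k" for i j k
    using pf_metric_centered_layout[OF pf(1) tri] pf_metric_centered_layout[OF pf(2) tri]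
      height_cong[of d' i j k _ _ _ _ d] eq'[OF tri] tri
    unfolding is_triangle_def by metis
  then have "dual_length T d' i j = dual_length T d i j" for i j
    by (simp add: dual_length_def)
  moreover have "ceva_sum d' i j k = ceva_sum d i j k" if "(i, j, k) \<in> triangles T" for i j k
    using that eq'[of i j k] unfolding ceva_sum_def triangles_def is_triangle_def by auto
  ultimately show ?thesis
    unfolding stable_metric_def by auto
qed

lemma stable_metric_if_pos:
  assumes cpx: "abstract_complex T" and pos: "\<And>i j. (i, j) \<in> directed_edges T \<Longrightarrow> d i j > 0"
  shows "stable_metric T d"
proof -
  have "ceva_sum d i j k > 0" if tri: "is_triangle T i j k" for i j k
  proof -
    have "d a b > 0" if "a \<in> {i, j, k}" "b \<in> {i, j, k}" "a \<noteq> b" for a b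
      by (rule pos[OF triangle_edges[OF cpx tri that]])
    then show ?thesis
      using tri unfolding ceva_sum_def is_triangle_def by (intro add_pos_pos mult_pos_pos) auto
  qed
  then show ?thesis by (auto simp: stable_metric_def triangles_def)
qed

lemma stable_metric_if_center_in_circumcircle:
  fixes T :: "'v::finite set set"
  assumes pf: "pf_metric T d"
    and "\<And>i j k (p :: 'v \<Rightarrow> real ^ 2). is_triangle T i j k \<Longrightarrow> realizes (len d) {i, j, k} p \<Longrightarrow>
      center_in_circumcircle d {i, j, k} p"
  shows "stable_metric T d"
proof -
  have "ceva_sum d i j k > 0" if tri: "is_triangle T i j k" for i j k
  proof -
    obtain X Y u w where lay: "centered_layout d {i, j, k} X Y u w"
      using pf_metric_centered_layout[OF pf tri] by blast
    have ne: "i \<noteq> j" "j \<noteq> k" "i \<noteq> k" using tri by (auto simp: is_triangle_def)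
    note real = centered_layout_realizes[OF lay ne]
    show ?thesis
      by (rule ceva_sum_pos_center_in_circumcircle[OF real ne assms(2)[OF tri real]])
  qed
  then show ?thesis by (auto simp: stable_metric_def triangles_def)
qed

lemma fixed_inversive_distance_pos:
  assumes "\<eta> {i, j} \<ge> 0"
  shows "fixed_inversive_distance \<eta> g i j > 0"
  unfolding fixed_inversive_distance_def using assms
  by (intro divide_pos_pos mult_pos_pos real_sqrt_gt_zero add_pos_nonneg add_pos_pos mult_nonneg_nonneg) auto

lemma perpendicular_bisector_pos:
  assumes "piecewise_flat T (\<lambda>i j. L {i, j})" "(i, j) \<in> directed_edges T"
  shows "perpendicular_bisector L g i j > 0"
proof -
  have ij: "i \<noteq> j" "{i, j} \<in> T" using assms(2) by (auto simp: directed_edges_def)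
  obtain p :: "'a \<Rightarrow> real ^ 'a" where "realizes (\<lambda>i j. L {i, j}) {i, j} p"
    using assms(1) ij(2) unfolding piecewise_flat_def by blast
  then have "p i \<noteq> p j" "dist (p i) (p j) = L {i, j}"
    using ij(1) by (auto simp: realizes_def inj_on_def)
  then have "L {i, j} > 0" by (metis zero_less_dist_iff)
  then show ?thesis by (simp add: perpendicular_bisector_def)
qed


section \<open>Rigidity\<close>

theorem theorem43:
  fixes M :: "'m topology"
    and T :: "'v::finite set set"
    and d :: "'v \<Rightarrow> 'v \<Rightarrow> real"
    and f :: "real \<Rightarrow> real ^ 'v"
    and \<epsilon> :: real
    and U :: "(real ^ 'v) set"
    and C :: "real ^ 'v \<Rightarrow> 'v \<Rightarrow> 'v \<Rightarrow> real"
  assumes "triangulated_manifold 2 M T" and "compact_space M" and "connected_space M"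
    and "pf_metric T d"
    and "\<forall>i. curvature T (len d) i = 0"
    and "(\<forall>(i, j)\<in>directed_edges T. dual_length T d i j > 0) \<or>
         (\<exists>\<eta>. (\<forall>(i, j)\<in>directed_edges T. \<eta> {i, j} \<ge> 0) \<and>
              in_image_of_structure T (fixed_inversive_distance \<eta>) d) \<or>
         (\<forall>(i, j)\<in>directed_edges T. d i j > 0) \<or>
         (\<exists>L. piecewise_flat T (\<lambda>i j. L {i, j}) \<and>
              in_image_of_structure T (perpendicular_bisector L) d) \<or>
         (\<forall>i j k. is_triangle T i j k \<longrightarrow>
            (\<forall>p :: 'v \<Rightarrow> real ^ 2. realizes (len d) {i, j, k} p \<longrightarrow>
               center_in_circumcircle d {i, j, k} p))"
    and "conformal_variation T d \<epsilon> f U C"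
    and "\<forall>t\<in>{-\<epsilon><..<\<epsilon>}. \<forall>i. curvature T (len (C (f t))) i = 0"
  shows "\<exists>\<delta>>0. \<delta> \<le> \<epsilon> \<and>
           (\<exists>s :: real \<Rightarrow> real. \<forall>t\<in>{-\<delta><..<\<delta>}. s t > 0 \<and>
              (\<forall>(i, j)\<in>directed_edges T. len (C (f t)) i j = s t * len (C (f 0)) i j))"
proof -
  have cpx: "abstract_complex T"
    using assms(1) by (simp add: triangulated_manifold_def)
  have \<epsilon>: "0 < \<epsilon>" and smooth: "smooth_on {-\<epsilon><..<\<epsilon>} f" and C: "conformal_structure T U C"
    and U: "f ` {-\<epsilon><..<\<epsilon>} \<subseteq> U"
    and start: "\<And>i j. (i, j) \<in> directed_edges T \<Longrightarrow> C (f 0) i j = d i j"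
    using assms(7) by (auto simp: conformal_variation_def)
  have pf: "pf_metric T (C (f t))" if "t \<in> {-\<epsilon><..<\<epsilon>}" for t
    using C U that unfolding conformal_structure_def by blast
  have f': "(f has_vector_derivative vector_derivative f (at t)) (at t)" if "t \<in> {-\<epsilon><..<\<epsilon>}" for t
    using smooth_on_imp_differentiable[OF smooth that] vector_derivative_works by blast
  have 0: "0 \<in> {-\<epsilon><..<\<epsilon>}" using \<epsilon> by simp
  have pure: "\<exists>k. is_triangle T i j k" if "(i, j) \<in> directed_edges T" for i j
    using edge_in_triangle[OF assms(1) that] by blast
  have "stable_metric T d"
    using assms(6)
  proof (elim disjE exE conjE)
    assume "\<forall>(i, j)\<in>directed_edges T. dual_length T d i j > 0"
    then show ?thesis by (simp add: stable_metric_def)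
  next
    fix \<eta> assume "\<forall>(i, j)\<in>directed_edges T. \<eta> {i, j} \<ge> 0"
      and "in_image_of_structure T (fixed_inversive_distance \<eta>) d"
    then have "d i j > 0" if "(i, j) \<in> directed_edges T" for i j
      using that fixed_inversive_distance_pos[of \<eta> i j] unfolding in_image_of_structure_def by fastforce
    then show ?thesis by (rule stable_metric_if_pos[OF cpx])
  next
    assume "\<forall>(i, j)\<in>directed_edges T. d i j > 0"
    then show ?thesis by (intro stable_metric_if_pos[OF cpx]) auto
  next
    fix L assume "piecewise_flat T (\<lambda>i j. L {i, j})"
      and "in_image_of_structure T (perpendicular_bisector L) d"
    then have "d i j > 0" if "(i, j) \<in> directed_edges T" for i j
      using that perpendicular_bisector_pos[of T L i j] unfolding in_image_of_structure_def by fastforce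
    then show ?thesis by (rule stable_metric_if_pos[OF cpx])
  next
    assume "\<forall>i j k. is_triangle T i j k \<longrightarrow>
            (\<forall>p :: 'v \<Rightarrow> real ^ 2. realizes (len d) {i, j, k} p \<longrightarrow>
               center_in_circumcircle d {i, j, k} p)"
    then show ?thesis by (intro stable_metric_if_center_in_circumcircle[OF assms(4)]) blast
  qed
  then have "stable_metric T (C (f 0))"
    using stable_metric_cong[OF cpx assms(4) pf[OF 0] start] by blast
  moreover have "isCont (\<lambda>s. C (f s) i j) 0" if "(i, j) \<in> directed_edges T" for i j
  proof (rule isCont_o2[where f = f and g = "\<lambda>g. C g i j"])
    show "isCont f 0"
      using f'[OF 0] has_vector_derivative_continuous by blast
    show "isCont (\<lambda>g. C g i j) (f 0)"
      using conformal_structure_differentiable[OF C that] U 0 differentiable_imp_continuous_within by blast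
  qed
  ultimately have "\<forall>\<^sub>F t in nhds 0. stable_metric T (C (f t))"
    by (intro eventually_stable_metric[OF cpx _ 0]) (auto intro: pf)
  then obtain \<delta>' where \<delta>': "\<delta>' > 0" "\<And>t. dist t 0 < \<delta>' \<Longrightarrow> stable_metric T (C (f t))"
    unfolding eventually_nhds_metric by blast
  define \<delta> where "\<delta> = min \<delta>' \<epsilon>"
  have \<delta>: "\<delta> > 0" "\<delta> \<le> \<epsilon>" using \<delta>'(1) \<epsilon> by (auto simp: \<delta>_def)
  have I: "t \<in> {-\<epsilon><..<\<epsilon>}" if "t \<in> {-\<delta><..<\<delta>}" for t
    using that \<delta> by auto
  \<comment> \<open>An arbitrary vertex.\<close>
  define v0 :: 'v where "v0 = undefined"
  have const: "vector_derivative f (at t) $ v = vector_derivative f (at t) $ v0"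
    if t: "t \<in> {-\<delta><..<\<delta>}" for t v
  proof -
    let ?x = "vector_derivative f (at t)"
    have "stable_metric T (C (f t))"
      using t by (intro \<delta>'(2)) (auto simp: \<delta>_def dist_norm)
    moreover have "dirichlet_energy T (C (f t)) (\<lambda>i. ?x $ i) = 0"
      using assms(8) by (intro flat_variation_dirichlet_energy[OF C cpx _ I[OF t] U f'[OF I[OF t]]]) auto
    ultimately have "?x $ i = ?x $ j" if "(i, j) \<in> directed_edges T" for i j
      using dirichlet_energy_zero[OF cpx pf[OF I[OF t]] pure _ _ that]
      unfolding stable_metric_def by blast
    then have "{v. ?x $ v = ?x $ v0} = UNIV"
      by (intro edge_connected[OF assms(1,3), of _ v0]) force+
    then show ?thesis by blast
  qed
  have scale: "len (C (f t)) i j = exp (f t $ v0 - f 0 $ v0) * len (C (f 0)) i j"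
    if t: "t \<in> {-\<delta><..<\<delta>}" and edge: "(i, j) \<in> directed_edges T" for t i j
  proof -
    \<comment> \<open>The length divided by its expected growth.\<close>
    let ?\<psi> = "\<lambda>s. len (C (f s)) i j * exp (- (f s $ v0))"
    have "(?\<psi> has_real_derivative 0) (at s)" if s: "s \<in> {-\<delta><..<\<delta>}" for s
    proof -
      let ?x = "vector_derivative f (at s)"
      have "f s \<in> U" using U I[OF s] by blast
      then have "((\<lambda>s. len (C (f s)) i j) has_real_derivative len (C (f s)) i j * ?x $ v0) (at s)"
        using conformal_len_has_derivative[OF C edge f'[OF I[OF s]]] const[OF s, of i] const[OF s, of j]
        by (simp add: len_def distrib_right)
      moreover have "((\<lambda>s. f s $ v0) has_real_derivative ?x $ v0) (at s)"
        using f'[OF I[OF s]] bounded_linear.has_vector_derivative[OF bounded_linear_vec_nth]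
        unfolding has_real_derivative_iff_has_vector_derivative by blast
      ultimately show ?thesis
        by (auto intro!: derivative_eq_intros)
    qed
    then have "?\<psi> t = ?\<psi> 0"
      using DERIV_isconst3[of "-\<delta>" \<delta> t 0 ?\<psi>] t \<delta> by auto
    then show ?thesis
      by (simp add: exp_minus exp_diff field_simps)
  qed
  show ?thesis
  proof (intro exI conjI ballI)
    show "\<delta> > 0" "\<delta> \<le> \<epsilon>" by (rule \<delta>)+
    show "exp (f t $ v0 - f 0 $ v0) > 0" for t by simp
    show "case e of (i, j) \<Rightarrow> len (C (f t)) i j = exp (f t $ v0 - f 0 $ v0) * len (C (f 0)) i j"
      if "t \<in> {-\<delta><..<\<delta>}" "e \<in> directed_edges T" for t e
      using scale[OF that(1)] that(2) by auto
  qed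
qed

end
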